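(* Let $R$ be an elliptic root system with marking, $\widetilde c\in W$ a hyperbolic Coxeter transformation with semi-simple part $\widetilde c^{ss}$, and $\zeta$ the unique primitive $d_n$-th root of unity with $\widetilde c^{ss}\cdot f=\zeta^mf$ for all $f\in S^W_m$, $m\ge0$. If the codimension of the elliptic root system is $1$, then the $\mathbb C$-span of good basic invariants for the admissible triplet $(\widetilde c^{ss},\zeta,L)$ does not depend on the choice of $L\in\widetilde X^{\widetilde c^{ss}}\cap\widetilde X^{reg}$ under the assumption that $L$ is of zero type.
   Context: Root system. $l\ge 1$ is an integer, $n=l+1$. $F$ is a real vector space of dimension $l+2$ with a positive semi-definite symmetric bilinear form $I$ whose radical $\mathrm{rad}\,I$ has dimension $2$. For $\alpha\in F$ with $I(\alpha,\alpha)\ne0$ put $\alpha^\vee=2\alpha/I(\alpha,\alpha)$, $w_\alpha(u)=u-I(u,\alpha^\vee)\alpha$. $R\subset F$ is an elliptic root system belonging to $(F,I)$: a set of vectors with $I(\alpha,\alpha)\neq 0$ such that (1) the additive group $Q(R)$ generated by $R$ is a full lattice in $F$; (2) $I(\alpha,\beta^\vee)\in\mathbb Z$ for $\alpha,\beta\in R$; (3) $w_\alpha(R)=R$ for $\alpha\in R$; (4) if $R=R_1\cup R_2$ with $R_1\perp R_2$ then $R_1$ or $R_2$ is empty. A marking is fixed: a line $G\subset\mathrm{rad}\,I$ with $G\cap Q(R)\simeq\mathbb Z$; $a,\delta$ are chosen with $G\cap Q(R)=\mathbb Za$, $Q(R)\cap\mathrm{rad}\,I=\mathbb Za\oplus\mathbb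 Z\delta$. $(I_R:I)>0$ is the smallest number such that $(I_R:I)I$ makes $Q(R)$ an even lattice. Hyperbolic extension. $\widetilde F\supset F$ is a real vector space of dimension $l+3$ with symmetric bilinear form $\widetilde I$, $\widetilde I|_F=I$, $\mathrm{rad}\,\widetilde I=\mathbb Ra$; $\Lambda_0\in\widetilde F$ satisfies $\widetilde I(\Lambda_0,\delta)=1$, $\widetilde I(\Lambda_0,\Lambda_0)=0$. $O(F,\mathrm{rad}\,I)$ is the group of $g\in GL(F)$ preserving $I$ with $g|_{\mathrm{rad}\,I}=id$; $O(\widetilde F,F,\mathrm{rad}\,I)$ is the group of $g\in GL(\widetilde F)$ preserving $\widetilde I$ with $g(F)\subset F$ and $g|_F\in O(F,\mathrm{rad}\,I)$; $K_{\mathbb R}$ is the kernel of the restriction map $O(\widetilde F,F,\mathrm{rad}\,I)\to O(F,\mathrm{rad}\,I)$. The elliptic Weyl group $W\subset O(\widetilde F,F,\mathrm{rad}\,I)$ is generated by $\widetilde w_\alpha(u)=u-\widetilde I(u,\alpha^\vee)\alpha$ ($\alpha\in R$); $K_{\mathbb Z}:=W\cap K_{\mathbb R}\simeq\mathbb Z$. Exponents. Following Saito, the image of $R$ in $F/G$ is a reduced affine root system. Let $\alpha_0,\dots,\alpha_l\in R$ be lifts of its simple roots, $n_i$ the coprime positive integers with $\sum n_i\alpha_i\equiv\pm\delta$ mod $G$, $k(\alpha)=\min\{k\in\mathbb Z_{>0}\mid\alpha+ka\in R\}$. The exponents $m_0\le\dots\le m_l=:m_{max}$ are the numbers $(I_R:I)I(\alpha_i,\alpha_i)n_i/(2k(\alpha_i))$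 in increasing order. $d_n$ is the smallest common denominator of the $m_i/m_{max}$, and $d_\alpha:=m_{\alpha-1}d_n/m_{max}$ ($1\le\alpha\le n$); $d=(d_1,\dots,d_n)$. The codimension is $\#\{i\mid d_i=d_n\}$. Invariants. $Y=\{x\in\mathrm{Hom}_{\mathbb R}(\widetilde F,\mathbb C)\mid\langle a,x\rangle=-2\pi\sqrt{-1},\ \mathrm{Re}\langle\delta,x\rangle>0\}$, $H=\{x\in\mathrm{Hom}_{\mathbb R}(\mathrm{rad}\,I,\mathbb C)\mid \langle a,x\rangle=-2\pi\sqrt{-1},\ \mathrm{Re}\langle\delta,x\rangle>0\}$, $\pi:Y\to H$ restriction; $F(Y),F(H)$ are the rings of holomorphic functions, $F(H)\subset F(Y)$ via $\pi^*$. $g\in O(\widetilde F,F,\mathrm{rad}\,I)$ acts on $Y$ by $\langle\gamma,g\cdot x\rangle=\langle g^{-1}\gamma,x\rangle$ and on functions by $(g\cdot f)(x)=f(g^{-1}x)$. The Euler field $E$ is the vector field on $Y$ with $E(f)=0$ for $f\in F$ and $E(\Lambda_0)=(I_R:I)d_n/m_{max}$. $S^W_m$ is the set of $W$-invariant $f\in F(Y)$ with $Ef=mf$; $S^W=\bigoplus_{m\ge0}S^W_m$. It is known that $S^W$ is a polynomial $F(H)$-algebra on algebraically independent homogeneous generators $x^1,\dots,x^n$ of degrees $0<d_1\le\dots\le d_n$, called a set of basic invariants. Hyperbolic Coxeter transformation. By a theorem of Saito (taken as given) there is $\widetilde c\in W$, called a hyperbolic Coxeter transformation, such that, with $c:=\widetilde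 c|_F$: (A) $c$ is semi-simple of order $d_n$, with eigenvalues $1$ and $\exp(2\pi\sqrt{-1}\,d_\alpha/d_n)$ ($\alpha=1,\dots,n$); (B) $R\cap\mathrm{Im}(c-id)=\emptyset$; (C) $(\widetilde c-1)\xi+(I_R:I)\widetilde I(\xi,\delta)\frac1{m_{max}}a\in\mathrm{Im}(c-id)$ for all $\xi\in\widetilde F$, and $\widetilde c^{\,d_n}$ generates $K_{\mathbb Z}$. $\widetilde c=\widetilde c^{ss}\cdot\widetilde c^{unip}$ is the Jordan decomposition. $\widetilde X=\{V\subset\widetilde F\mid\widetilde F=V\oplus\mathrm{rad}\,I\}$, $\widetilde X^{reg}=\{V\in\widetilde X\mid V\cap R=\emptyset\}$, $\widetilde X^{\widetilde c^{ss}}=\{V\in\widetilde X\mid\widetilde c^{ss}V=V\}$. $V\in\widetilde X$ is of zero type if $\widetilde I|_V$ has $n-1$ positive, one zero and no negative eigenvalues. Admissible triplet. $(g,\zeta,L)$ ($g\in O(\widetilde F,F,\mathrm{rad}\,I)$, $\zeta\in\mathbb C^*$, $L\subset\widetilde F$ a subspace) is admissible if: (i) $g$ is semi-simple, $(g-id)(\widetilde F)\subset F$; (ii) $\zeta$ is a primitive $d_n$-th root of unity and $g\cdot x^\alpha=\zeta^{d_\alpha}x^\alpha$ ($1\le\alpha\le n$) for a set of basic invariants; (iii) $\widetilde F=L\oplus\mathrm{rad}\,I$, $g(L)=L$, $L\cap R=\emptyset$. For $L\in\widetilde X^{\widetilde c^{ss}}\cap\widetilde X^{reg}$, $(\widetilde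 c^{ss},\zeta,L)$ is admissible. Good basic invariants for an admissible $(g,\zeta,L)$. $L^\perp=\{x\in Y\mid\langle v,x\rangle=0\ \forall v\in L\}$; $\pi$ gives $L^\perp\simeq H$, so $f|_{L^\perp}\in F(H)$ for $f\in F(Y)$. A $g$-homogeneous basis is a $\mathbb C$-basis $z^1,\dots,z^n$ of $L\otimes\mathbb C$ with $g\cdot z^\alpha=\zeta^{d_\alpha}z^\alpha$ (it exists); with $z^0=\delta/(-2\pi\sqrt{-1})$ it gives coordinates $(z^0,\dots,z^n)$ on $Y$. $F(H)[L]=F(H)[z^1,\dots,z^n]$ graded by $\deg z^\alpha=d_\alpha$. The map $$\psi[g,\zeta,L]:S^W\to F(H)[L],\quad x^a\mapsto\sum_{b\in\mathbb Z_{\ge0}^n,\ d\cdot b=d\cdot a}\frac1{b!}\left.\frac{\partial^b\big(\prod_\gamma(x^\gamma-x^\gamma|_{L^\perp})^{a_\gamma}\big)}{\partial z^b}\right|_{L^\perp}z^b\quad(a\in\mathbb Z^n_{\ge0}),$$ extended $F(H)$-linearly, is independent of choices and is an isomorphism of graded $F(H)$-algebras. A set of basic invariants is good with respect to $(g,\zeta,L)$ if it is a $\mathbb C$-basis of $\psi[g,\zeta,L]^{-1}(L\otimes_{\mathbb R}\mathbb C)$. *)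

theory Defs
  imports
    "HOL-Analysis.Analysis"
    "HOL-Algebra.Bij"
    "HOL-Algebra.Generated_Groups"
    "HOL-Library.Function_Algebras"
    "HOL-Library.FuncSet"
begin

section \<open>Elliptic root systems\<close>

text \<open>The ambient type is the hyperbolic extension (a real vector space of dimension \<open>l + 3\<close>);
  the space \<open>F\<close> is a subspace of it and the form on \<open>F\<close> is the restriction of the ambient form.
  The norm and inner product carried by the class \<open>euclidean_space\<close> only serve to provide the
  topology of a finite-dimensional space.\<close>

record 'v elliptic_data =
  rnk :: nat                          (* l *)
  Form :: "'v \<Rightarrow> 'v \<Rightarrow> real"            (* the form on the hyperbolic extension *)
  Fsp :: "'v set"                     (* F *)
  Roots :: "'v set"                   (* R *)
  Mark :: "'v set"                    (* G *)
  avec :: 'v                          (* a *)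
  dvec :: 'v                          (* delta *)
  Lam0 :: 'v                          (* Lambda_0 *)
  sroot :: "nat \<Rightarrow> 'v"                (* alpha_0, ..., alpha_l *)
  lbl :: "nat \<Rightarrow> nat"                 (* n_0, ..., n_l *)

definition form_rad :: "('v \<Rightarrow> 'v \<Rightarrow> real) \<Rightarrow> 'v set \<Rightarrow> 'v set" where
  "form_rad B V = {u \<in> V. \<forall>v\<in>V. B u v = 0}"

definition coroot :: "('v \<Rightarrow> 'v \<Rightarrow> real) \<Rightarrow> 'v \<Rightarrow> 'v::real_vector" where
  "coroot B \<alpha> = (2 / B \<alpha> \<alpha>) *\<^sub>R \<alpha>"

definition reflection :: "('v \<Rightarrow> 'v \<Rightarrow> real) \<Rightarrow> 'v \<Rightarrow> 'v \<Rightarrow> 'v::real_vector" where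
  "reflection B \<alpha> u = u - B u (coroot B \<alpha>) *\<^sub>R \<alpha>"

definition root_lattice :: "'v set \<Rightarrow> 'v::real_vector set" where
  "root_lattice S = {(\<Sum>\<alpha>\<in>A. of_int (c \<alpha>) *\<^sub>R \<alpha>) | A (c :: 'v \<Rightarrow> int). finite A \<and> A \<subseteq> S}"

definition full_lattice :: "'v set \<Rightarrow> 'v::real_vector set \<Rightarrow> bool" where
  "full_lattice Q V \<longleftrightarrow>
     (\<exists>b. finite b \<and> independent b \<and> span b = V \<and> Q = root_lattice b)"

definition elliptic_root_system ::
  "('v \<Rightarrow> 'v \<Rightarrow> real) \<Rightarrow> 'v::real_vector set \<Rightarrow> 'v set \<Rightarrow> bool" where
  "elliptic_root_system B V R \<longleftrightarrow>
     R \<subseteq> V \<and> (\<forall>\<alpha>\<in>R. B \<alpha> \<alpha> \<noteq> 0) \<and>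
     full_lattice (root_lattice R) V \<and>
     (\<forall>\<alpha>\<in>R. \<forall>\<beta>\<in>R. B \<alpha> (coroot B \<beta>) \<in> \<int>) \<and>
     (\<forall>\<alpha>\<in>R. reflection B \<alpha> ` R = R) \<and>
     (\<forall>R1 R2. R = R1 \<union> R2 \<longrightarrow> (\<forall>\<alpha>\<in>R1. \<forall>\<beta>\<in>R2. B \<alpha> \<beta> = 0) \<longrightarrow> R1 = {} \<or> R2 = {})"

abbreviation radI :: "'v elliptic_data \<Rightarrow> 'v set" where
  "radI E \<equiv> form_rad (Form E) (Fsp E)"

definition marking :: "'v::real_vector elliptic_data \<Rightarrow> bool" where
  "marking E \<longleftrightarrow>
     subspace (Mark E) \<and> dim (Mark E) = 1 \<and> Mark E \<subseteq> radI E \<and>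
     avec E \<noteq> 0 \<and>
     Mark E \<inter> root_lattice (Roots E) = {of_int k *\<^sub>R avec E | k :: int. True} \<and>
     root_lattice (Roots E) \<inter> radI E =
       {of_int k *\<^sub>R avec E + of_int m *\<^sub>R dvec E | (k :: int) (m :: int). True} \<and>
     (\<forall>(k :: int) (m :: int). of_int k *\<^sub>R avec E + of_int m *\<^sub>R dvec E = 0 \<longrightarrow> k = 0 \<and> m = 0)"

text \<open>The image of \<open>R\<close> in \<open>F/G\<close> is reduced: proportional roots modulo \<open>G\<close> agree up to sign
  modulo \<open>G\<close>.\<close>

definition reduced_quotient :: "'v::real_vector elliptic_data \<Rightarrow> bool" where
  "reduced_quotient E \<longleftrightarrow>
     (\<forall>\<alpha>\<in>Roots E. \<forall>\<beta>\<in>Roots E. \<forall>r :: real. \<beta> - r *\<^sub>R \<alpha> \<in> Mark E \<longrightarrow> r = 1 \<or> r = - 1)"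

text \<open>The images of \<open>\<alpha>\<^sub>0, \<dots>, \<alpha>\<^sub>l\<close> in \<open>F/G\<close> are a system of simple roots of the image of \<open>R\<close>, and
  \<open>n\<^sub>0, \<dots>, n\<^sub>l\<close> are its labels.\<close>

definition simple_root_lifts :: "'v::real_vector elliptic_data \<Rightarrow> bool" where
  "simple_root_lifts E \<longleftrightarrow>
     (\<forall>i\<le>rnk E. sroot E i \<in> Roots E) \<and>
     (\<forall>r :: nat \<Rightarrow> real. (\<Sum>i\<le>rnk E. r i *\<^sub>R sroot E i) \<in> Mark E \<longrightarrow> (\<forall>i\<le>rnk E. r i = 0)) \<and>
     (\<forall>\<beta>\<in>Roots E. \<exists>k :: nat \<Rightarrow> nat.
        \<beta> - (\<Sum>i\<le>rnk E. real (k i) *\<^sub>R sroot E i) \<in> Mark E \<or>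
        \<beta> + (\<Sum>i\<le>rnk E. real (k i) *\<^sub>R sroot E i) \<in> Mark E) \<and>
     (\<forall>i\<le>rnk E. 0 < lbl E i) \<and> Gcd (lbl E ` {..rnk E}) = 1 \<and>
     ((\<Sum>i\<le>rnk E. real (lbl E i) *\<^sub>R sroot E i) - dvec E \<in> Mark E \<or>
      (\<Sum>i\<le>rnk E. real (lbl E i) *\<^sub>R sroot E i) + dvec E \<in> Mark E)"

definition hyperbolic_extension :: "'v::real_vector elliptic_data \<Rightarrow> bool" where
  "hyperbolic_extension E \<longleftrightarrow>
     form_rad (Form E) UNIV = span {avec E} \<and>
     Form E (Lam0 E) (dvec E) = 1 \<and> Form E (Lam0 E) (Lam0 E) = 0"

definition marked_elliptic_root_system :: "'v::euclidean_space elliptic_data \<Rightarrow> bool" where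
  "marked_elliptic_root_system E \<longleftrightarrow>
     1 \<le> rnk E \<and> DIM('v) = rnk E + 3 \<and>
     bilinear (Form E) \<and> (\<forall>u v. Form E u v = Form E v u) \<and>
     subspace (Fsp E) \<and> dim (Fsp E) = rnk E + 2 \<and>
     (\<forall>u\<in>Fsp E. 0 \<le> Form E u u) \<and> dim (radI E) = 2 \<and>
     elliptic_root_system (Form E) (Fsp E) (Roots E) \<and>
     marking E \<and> reduced_quotient E \<and> simple_root_lifts E \<and> hyperbolic_extension E"

section \<open>Exponents\<close>

abbreviation nn :: "'v elliptic_data \<Rightarrow> nat" where
  "nn E \<equiv> rnk E + 1"

text \<open>The number \<open>(I\<^sub>R : I)\<close>.\<close>

definition even_scale :: "'v::real_vector elliptic_data \<Rightarrow> real" where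
  "even_scale E = (LEAST c. 0 < c \<and>
     (\<forall>u\<in>root_lattice (Roots E). \<exists>k :: int. c * Form E u u = 2 * of_int k))"

definition kmin :: "'v::real_vector elliptic_data \<Rightarrow> 'v \<Rightarrow> nat" where
  "kmin E \<alpha> = (LEAST k. 0 < k \<and> \<alpha> + real k *\<^sub>R avec E \<in> Roots E)"

definition exponents :: "'v::real_vector elliptic_data \<Rightarrow> real list" where
  "exponents E = sort (map (\<lambda>i. even_scale E * Form E (sroot E i) (sroot E i) * real (lbl E i) /
     (2 * real (kmin E (sroot E i)))) [0..<nn E])"

definition mmax :: "'v::real_vector elliptic_data \<Rightarrow> real" where
  "mmax E = exponents E ! rnk E"

definition dmax :: "'v::real_vector elliptic_data \<Rightarrow> nat" where
  "dmax E = (LEAST D. 0 < D \<and> (\<forall>i\<le>rnk E. real D * (exponents E ! i / mmax E) \<in> \<int>))"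

text \<open>Indices run through \<open>0, \<dots>, n - 1\<close> instead of \<open>1, \<dots>, n\<close>: \<open>deg E i\<close> is \<open>d\<^sub>i\<^sub>+\<^sub>1\<close>, and \<open>dmax E\<close>
  is \<open>d\<^sub>n\<close>. The number inside the floor is an integer.\<close>

definition deg :: "'v::real_vector elliptic_data \<Rightarrow> nat \<Rightarrow> nat" where
  "deg E i = nat \<lfloor>exponents E ! i * real (dmax E) / mmax E\<rfloor>"

definition codimension :: "'v::real_vector elliptic_data \<Rightarrow> nat" where
  "codimension E = card {i. i < nn E \<and> deg E i = dmax E}"

section \<open>Complexifications\<close>

text \<open>The complexification of a real space \<open>V\<close> is \<open>V \<times> V\<close>, where \<open>(u, v)\<close> stands for \<open>u + \<i>v\<close>;
  a real-linear map \<open>g\<close> acts on it as \<open>map_prod g g\<close>.\<close>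

definition cscale :: "complex \<Rightarrow> 'v \<times> 'v \<Rightarrow> 'v::real_vector \<times> 'v" where
  "cscale c w = (Re c *\<^sub>R fst w - Im c *\<^sub>R snd w, Re c *\<^sub>R snd w + Im c *\<^sub>R fst w)"

global_interpretation cvec: vector_space "cscale :: complex \<Rightarrow> 'v::real_vector \<times> 'v \<Rightarrow> 'v \<times> 'v"
  by unfold_locales (auto simp: cscale_def algebra_simps)

definition fscale :: "complex \<Rightarrow> ('b \<Rightarrow> complex) \<Rightarrow> 'b \<Rightarrow> complex" where
  "fscale c f = (\<lambda>y. c * f y)"

global_interpretation cfun: vector_space "fscale :: complex \<Rightarrow> ('b \<Rightarrow> complex) \<Rightarrow> 'b \<Rightarrow> complex"
  by unfold_locales (auto simp: fscale_def algebra_simps fun_eq_iff)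

definition cvec_basis :: "nat \<Rightarrow> (nat \<Rightarrow> 'v::real_vector \<times> 'v) \<Rightarrow> ('v \<times> 'v) set \<Rightarrow> bool" where
  "cvec_basis n w V \<longleftrightarrow> inj_on w {..<n} \<and> \<not> cvec.dependent (w ` {..<n}) \<and>
     cvec.span (w ` {..<n}) = V"

definition cfun_basis :: "nat \<Rightarrow> (nat \<Rightarrow> 'b \<Rightarrow> complex) \<Rightarrow> ('b \<Rightarrow> complex) set \<Rightarrow> bool" where
  "cfun_basis n x V \<longleftrightarrow> inj_on x {..<n} \<and> \<not> cfun.dependent (x ` {..<n}) \<and>
     cfun.span (x ` {..<n}) = V"

text \<open>\<open>g\<close> is diagonalizable on the complexification of \<open>V\<close>, with eigenvalues (with multiplicities)
  \<open>\<mu> 0, \<dots>, \<mu> (dim V - 1)\<close>.\<close>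

definition diagonalizable_with ::
  "'v::real_vector set \<Rightarrow> ('v \<Rightarrow> 'v) \<Rightarrow> (nat \<Rightarrow> complex) \<Rightarrow> bool" where
  "diagonalizable_with V g \<mu> \<longleftrightarrow> (\<exists>w. cvec_basis (dim V) w (V \<times> V) \<and>
     (\<forall>i<dim V. map_prod g g (w i) = cscale (\<mu> i) (w i)))"

definition semisimple_on :: "'v::real_vector set \<Rightarrow> ('v \<Rightarrow> 'v) \<Rightarrow> bool" where
  "semisimple_on V g \<longleftrightarrow> (\<exists>\<mu>. diagonalizable_with V g \<mu>)"

definition unipotent :: "('v \<Rightarrow> 'v::real_vector) \<Rightarrow> bool" where
  "unipotent g \<longleftrightarrow> (\<exists>k. (\<lambda>u. g u - u) ^^ k = (\<lambda>_. 0))"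

definition jordan_decomposition ::
  "('v \<Rightarrow> 'v::real_vector) \<Rightarrow> ('v \<Rightarrow> 'v) \<Rightarrow> ('v \<Rightarrow> 'v) \<Rightarrow> bool" where
  "jordan_decomposition g s u \<longleftrightarrow>
     linear s \<and> linear u \<and> g = s \<circ> u \<and> s \<circ> u = u \<circ> s \<and> semisimple_on UNIV s \<and> unipotent u"

definition primitive_root :: "nat \<Rightarrow> complex \<Rightarrow> bool" where
  "primitive_root k \<zeta> \<longleftrightarrow> 0 < k \<and> \<zeta> ^ k = 1 \<and> (\<forall>j. 0 < j \<and> j < k \<longrightarrow> \<zeta> ^ j \<noteq> 1)"

section \<open>Groups\<close>

text \<open>Since \<open>g\<close> is injective and \<open>F\<close> is finite-dimensional, \<open>g ` F \<subseteq> F\<close> makes the restriction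
  of \<open>g\<close> to \<open>F\<close> an element of \<open>GL(F)\<close>.\<close>

definition Otilde :: "'v::real_vector elliptic_data \<Rightarrow> ('v \<Rightarrow> 'v) set" where
  "Otilde E = {g. linear g \<and> bij g \<and> (\<forall>u v. Form E (g u) (g v) = Form E u v) \<and>
     g ` Fsp E \<subseteq> Fsp E \<and> (\<forall>u\<in>radI E. g u = u)}"

definition KR :: "'v::real_vector elliptic_data \<Rightarrow> ('v \<Rightarrow> 'v) set" where
  "KR E = {g \<in> Otilde E. \<forall>u\<in>Fsp E. g u = u}"

definition weyl :: "'v::real_vector elliptic_data \<Rightarrow> ('v \<Rightarrow> 'v) set" where
  "weyl E = generate (BijGroup UNIV) (reflection (Form E) ` Roots E)"

definition KZ :: "'v::real_vector elliptic_data \<Rightarrow> ('v \<Rightarrow> 'v) set" where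
  "KZ E = weyl E \<inter> KR E"

text \<open>The eigenvalues of the restriction to \<open>F\<close> are listed with multiplicities
  (\<open>dim F = n + 1\<close>).\<close>

definition hyperbolic_coxeter :: "'v::real_vector elliptic_data \<Rightarrow> ('v \<Rightarrow> 'v) \<Rightarrow> bool" where
  "hyperbolic_coxeter E c \<longleftrightarrow> c \<in> weyl E \<and>
     (let D = dmax E; Imc = (\<lambda>u. c u - u) ` Fsp E in
       diagonalizable_with (Fsp E) c
         (\<lambda>i. case i of 0 \<Rightarrow> 1 | Suc j \<Rightarrow> exp (2 * of_real pi * \<i> * of_nat (deg E j) / of_nat D)) \<and>
       0 < D \<and> (\<forall>u\<in>Fsp E. (c ^^ D) u = u) \<and>
       (\<forall>k. 0 < k \<and> k < D \<longrightarrow> (\<exists>u\<in>Fsp E. (c ^^ k) u \<noteq> u)) \<and>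
       Roots E \<inter> Imc = {} \<and>
       (\<forall>\<xi>. (c \<xi> - \<xi>) + (even_scale E * Form E \<xi> (dvec E) * (1 / mmax E)) *\<^sub>R avec E \<in> Imc) \<and>
       generate (BijGroup UNIV) {c ^^ D} = KZ E)"

section \<open>Splittings of the radical\<close>

definition complement_of_radI :: "'v::real_vector elliptic_data \<Rightarrow> 'v set \<Rightarrow> bool" where
  "complement_of_radI E V \<longleftrightarrow> subspace V \<and> V \<inter> radI E = {0} \<and>
     (\<forall>u. \<exists>v\<in>V. \<exists>r\<in>radI E. u = v + r)"

definition Xreg :: "'v::real_vector elliptic_data \<Rightarrow> 'v set set" where
  "Xreg E = {V. complement_of_radI E V \<and> V \<inter> Roots E = {}}"

definition Xinv :: "'v::real_vector elliptic_data \<Rightarrow> ('v \<Rightarrow> 'v) \<Rightarrow> 'v set set" where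
  "Xinv E g = {V. complement_of_radI E V \<and> g ` V = V}"

text \<open>Numbers of positive, zero and negative eigenvalues of a form on \<open>V\<close>, counted
  in an orthogonal basis (they do not depend on the basis by Sylvester's law of inertia).\<close>

definition has_signature ::
  "('v \<Rightarrow> 'v \<Rightarrow> real) \<Rightarrow> 'v::real_vector set \<Rightarrow> nat \<Rightarrow> nat \<Rightarrow> nat \<Rightarrow> bool" where
  "has_signature B V p z q \<longleftrightarrow>
     (\<exists>b. finite b \<and> independent b \<and> span b = V \<and> (\<forall>u\<in>b. \<forall>v\<in>b. u \<noteq> v \<longrightarrow> B u v = 0) \<and>
        card {u \<in> b. 0 < B u u} = p \<and> card {u \<in> b. B u u = 0} = z \<and> card {u \<in> b. B u u < 0} = q)"

definition zero_type :: "'v::real_vector elliptic_data \<Rightarrow> 'v set \<Rightarrow> bool" where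
  "zero_type E V \<longleftrightarrow> complement_of_radI E V \<and> has_signature (Form E) V (nn E - 1) 1 0"

section \<open>The domain and its holomorphic functions\<close>

text \<open>The complex dual of the ambient space is \<open>'v \<Rightarrow>\<^sub>L complex\<close> (in finite dimension every
  linear map is bounded); \<open>hscale\<close> is its complex scalar multiplication, \<open>cpair\<close> its
  complex-linear pairing with the complexification.\<close>

definition hscale :: "complex \<Rightarrow> ('v \<Rightarrow>\<^sub>L complex) \<Rightarrow> ('v::euclidean_space \<Rightarrow>\<^sub>L complex)" where
  "hscale c x = blinfun_mult_right c o\<^sub>L x"

definition cpair :: "'v \<times> 'v \<Rightarrow> ('v::euclidean_space \<Rightarrow>\<^sub>L complex) \<Rightarrow> complex" where
  "cpair w x = blinfun_apply x (fst w) + \<i> * blinfun_apply x (snd w)"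

definition YY :: "'v::euclidean_space elliptic_data \<Rightarrow> ('v \<Rightarrow>\<^sub>L complex) set" where
  "YY E = {x. blinfun_apply x (avec E) = - 2 * of_real pi * \<i> \<and> 0 < Re (blinfun_apply x (dvec E))}"

text \<open>A real-linear map on the radical is represented by its extension by \<open>undefined\<close>.\<close>

definition HH :: "'v::euclidean_space elliptic_data \<Rightarrow> ('v \<Rightarrow> complex) set" where
  "HH E = {t \<in> extensional (radI E).
     (\<forall>u\<in>radI E. \<forall>v\<in>radI E. t (u + v) = t u + t v) \<and>
     (\<forall>r. \<forall>u\<in>radI E. t (r *\<^sub>R u) = of_real r * t u) \<and>
     t (avec E) = - 2 * of_real pi * \<i> \<and> 0 < Re (t (dvec E))}"

definition prH :: "'v::euclidean_space elliptic_data \<Rightarrow> ('v \<Rightarrow>\<^sub>L complex) \<Rightarrow> 'v \<Rightarrow> complex" where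
  "prH E x = restrict (blinfun_apply x) (radI E)"

text \<open>Functions on the domains are extended by \<open>0\<close>, so that equality of functions is equality
  on the domain. \<open>YY E\<close> is open in an affine space with tangent space \<open>{v. v a = 0}\<close>;
  holomorphic means differentiable along \<open>YY E\<close> with complex-linear differential on this tangent
  space. For \<open>HH E\<close>, the function \<open>t \<mapsto> t \<delta>\<close> is a global coordinate with values in the
  right half-plane.\<close>

definition FY :: "'v::euclidean_space elliptic_data \<Rightarrow> (('v \<Rightarrow>\<^sub>L complex) \<Rightarrow> complex) set" where
  "FY E = {f. (\<forall>x. x \<notin> YY E \<longrightarrow> f x = 0) \<and>
     (\<forall>x\<in>YY E. \<exists>D. (f has_derivative D) (at x within YY E) \<and>
        (\<forall>v. blinfun_apply v (avec E) = 0 \<longrightarrow> D (hscale \<i> v) = \<i> * D v))}"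

definition FH :: "'v::euclidean_space elliptic_data \<Rightarrow> (('v \<Rightarrow> complex) \<Rightarrow> complex) set" where
  "FH E = {h. (\<forall>t. t \<notin> HH E \<longrightarrow> h t = 0) \<and>
     (\<exists>\<phi>. \<phi> holomorphic_on {s. 0 < Re s} \<and> (\<forall>t\<in>HH E. h t = \<phi> (t (dvec E))))}"

definition act_pt :: "('v \<Rightarrow> 'v) \<Rightarrow> ('v \<Rightarrow>\<^sub>L complex) \<Rightarrow> ('v::euclidean_space \<Rightarrow>\<^sub>L complex)" where
  "act_pt g x = Blinfun (\<lambda>u. blinfun_apply x (inv_into UNIV g u))"

definition act_fun ::
  "('v \<Rightarrow> 'v) \<Rightarrow> (('v::euclidean_space \<Rightarrow>\<^sub>L complex) \<Rightarrow> complex) \<Rightarrow> ('v \<Rightarrow>\<^sub>L complex) \<Rightarrow> complex" where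
  "act_fun g f = (\<lambda>x. f (act_pt (inv_into UNIV g) x))"

text \<open>The Euler field has constant coefficients, being determined by its values on the linear
  functions; \<open>euler_vec\<close> is its value, a tangent vector. The equation \<open>E f = m f\<close> is expressed
  by the complex derivative along this vector.\<close>

definition euler_vec :: "'v::euclidean_space elliptic_data \<Rightarrow> ('v \<Rightarrow>\<^sub>L complex)" where
  "euler_vec E = (THE e. (\<forall>u\<in>Fsp E. blinfun_apply e u = 0) \<and>
     blinfun_apply e (Lam0 E) = of_real (even_scale E * real (dmax E) / mmax E))"

definition SWhom ::
  "'v::euclidean_space elliptic_data \<Rightarrow> nat \<Rightarrow> (('v \<Rightarrow>\<^sub>L complex) \<Rightarrow> complex) set" where
  "SWhom E m = {f \<in> FY E. (\<forall>w\<in>weyl E. act_fun w f = f) \<and>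
     (\<forall>x\<in>YY E. ((\<lambda>t. f (x + hscale t (euler_vec E))) has_field_derivative of_nat m * f x) (at 0))}"

definition SW :: "'v::euclidean_space elliptic_data \<Rightarrow> (('v \<Rightarrow>\<^sub>L complex) \<Rightarrow> complex) set" where
  "SW E = {f. \<exists>N g. (\<forall>m\<le>N. g m \<in> SWhom E m) \<and> f = (\<lambda>x. \<Sum>m\<le>N. g m x)}"

section \<open>Basic invariants\<close>

definition multi_index :: "nat \<Rightarrow> (nat \<Rightarrow> nat) set" where
  "multi_index n = {b. \<forall>i\<ge>n. b i = 0}"

definition wdeg :: "'v::real_vector elliptic_data \<Rightarrow> (nat \<Rightarrow> nat) \<Rightarrow> nat" where
  "wdeg E b = (\<Sum>i<nn E. deg E i * b i)"

text \<open>The sum of \<open>h\<^sub>b P\<^sub>b\<close> over the multi-indices \<open>b \<in> A\<close>, where the functions \<open>h\<^sub>b\<close> on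
  \<open>HH E\<close> are pulled back to \<open>YY E\<close>.\<close>

definition FH_comb ::
  "'v::euclidean_space elliptic_data \<Rightarrow> (nat \<Rightarrow> nat) set \<Rightarrow> ((nat \<Rightarrow> nat) \<Rightarrow> ('v \<Rightarrow> complex) \<Rightarrow> complex)
    \<Rightarrow> ((nat \<Rightarrow> nat) \<Rightarrow> ('v \<Rightarrow>\<^sub>L complex) \<Rightarrow> complex) \<Rightarrow> ('v \<Rightarrow>\<^sub>L complex) \<Rightarrow> complex" where
  "FH_comb E A h P = (\<lambda>y. if y \<in> YY E then (\<Sum>b\<in>A. h b (prH E y) * P b y) else 0)"

definition monomial ::
  "'v::euclidean_space elliptic_data \<Rightarrow> (nat \<Rightarrow> ('v \<Rightarrow>\<^sub>L complex) \<Rightarrow> complex) \<Rightarrow> (nat \<Rightarrow> nat)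
    \<Rightarrow> ('v \<Rightarrow>\<^sub>L complex) \<Rightarrow> complex" where
  "monomial E x b = (\<lambda>y. \<Prod>i<nn E. x i y ^ b i)"

definition basic_invariants ::
  "'v::euclidean_space elliptic_data \<Rightarrow> (nat \<Rightarrow> ('v \<Rightarrow>\<^sub>L complex) \<Rightarrow> complex) \<Rightarrow> bool" where
  "basic_invariants E x \<longleftrightarrow>
     (\<forall>i<nn E. 0 < deg E i) \<and> (\<forall>i j. i \<le> j \<and> j < nn E \<longrightarrow> deg E i \<le> deg E j) \<and>
     (\<forall>i<nn E. x i \<in> SWhom E (deg E i)) \<and>
     SW E = {FH_comb E A h (monomial E x) | A h.
       finite A \<and> A \<subseteq> multi_index (nn E) \<and> (\<forall>b\<in>A. h b \<in> FH E)} \<and>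
     (\<forall>A h. finite A \<and> A \<subseteq> multi_index (nn E) \<and> (\<forall>b\<in>A. h b \<in> FH E) \<and>
        FH_comb E A h (monomial E x) = (\<lambda>_. 0) \<longrightarrow> (\<forall>b\<in>A. h b = (\<lambda>_. 0)))"

section \<open>Good basic invariants\<close>

definition admissible_triplet ::
  "'v::euclidean_space elliptic_data \<Rightarrow> ('v \<Rightarrow> 'v) \<Rightarrow> complex \<Rightarrow> 'v set \<Rightarrow> bool" where
  "admissible_triplet E g \<zeta> L \<longleftrightarrow>
     g \<in> Otilde E \<and> semisimple_on UNIV g \<and> (\<forall>u. g u - u \<in> Fsp E) \<and>
     primitive_root (dmax E) \<zeta> \<and>
     (\<exists>x. basic_invariants E x \<and> (\<forall>i<nn E. act_fun g (x i) = fscale (\<zeta> ^ deg E i) (x i))) \<and>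
     complement_of_radI E L \<and> g ` L = L \<and> L \<inter> Roots E = {}"

text \<open>\<open>sec E L\<close> is the inverse of the bijection from \<open>L\<^sup>\<bottom>\<close> to \<open>HH E\<close> induced by \<open>prH E\<close>.\<close>

definition perpY :: "'v::euclidean_space elliptic_data \<Rightarrow> 'v set \<Rightarrow> ('v \<Rightarrow>\<^sub>L complex) set" where
  "perpY E L = {x \<in> YY E. \<forall>v\<in>L. blinfun_apply x v = 0}"

definition sec ::
  "'v::euclidean_space elliptic_data \<Rightarrow> 'v set \<Rightarrow> ('v \<Rightarrow> complex) \<Rightarrow> ('v \<Rightarrow>\<^sub>L complex)" where
  "sec E L t = (THE p. p \<in> perpY E L \<and> prH E p = t)"

definition homogeneous_basis ::
  "'v::real_vector elliptic_data \<Rightarrow> ('v \<Rightarrow> 'v) \<Rightarrow> complex \<Rightarrow> 'v set \<Rightarrow> (nat \<Rightarrow> 'v \<times> 'v) \<Rightarrow> bool" where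
  "homogeneous_basis E g \<zeta> L z \<longleftrightarrow> cvec_basis (nn E) z (L \<times> L) \<and>
     (\<forall>i<nn E. map_prod g g (z i) = cscale (\<zeta> ^ deg E i) (z i))"

text \<open>The coordinates on \<open>YY E\<close> are \<open>z\<^sup>0 = \<delta> / (- 2 \<pi> \<i>)\<close> and the \<open>cpair (z i)\<close>;
  \<open>coord_vec E z i\<close> is the constant vector field dual to \<open>cpair (z i)\<close>, so the partial derivative is
  the derivative along it.\<close>

definition coord_vec ::
  "'v::euclidean_space elliptic_data \<Rightarrow> (nat \<Rightarrow> 'v \<times> 'v) \<Rightarrow> nat \<Rightarrow> ('v \<Rightarrow>\<^sub>L complex)" where
  "coord_vec E z i = (THE e. blinfun_apply e (avec E) = 0 \<and> blinfun_apply e (dvec E) = 0 \<and>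
     (\<forall>j<nn E. cpair (z j) e = (if j = i then 1 else 0)))"

definition dir_deriv ::
  "('v::euclidean_space \<Rightarrow>\<^sub>L complex) \<Rightarrow> (('v \<Rightarrow>\<^sub>L complex) \<Rightarrow> complex) \<Rightarrow> ('v \<Rightarrow>\<^sub>L complex) \<Rightarrow> complex" where
  "dir_deriv e f = (\<lambda>y. deriv (\<lambda>t. f (y + hscale t e)) 0)"

definition multi_deriv ::
  "'v::euclidean_space elliptic_data \<Rightarrow> (nat \<Rightarrow> 'v \<times> 'v) \<Rightarrow> (nat \<Rightarrow> nat)
    \<Rightarrow> (('v \<Rightarrow>\<^sub>L complex) \<Rightarrow> complex) \<Rightarrow> ('v \<Rightarrow>\<^sub>L complex) \<Rightarrow> complex" where
  "multi_deriv E z b = foldr (\<lambda>i G. (dir_deriv (coord_vec E z i) ^^ b i) \<circ> G) [0..<nn E] id"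

text \<open>\<open>F(H)[L]\<close> is realized inside the holomorphic functions on \<open>YY E\<close>, the elements of the
  complexification of \<open>L\<close> acting by \<open>cpair\<close>.\<close>

definition psi_monomial ::
  "'v::euclidean_space elliptic_data \<Rightarrow> 'v set \<Rightarrow> (nat \<Rightarrow> 'v \<times> 'v) \<Rightarrow> (nat \<Rightarrow> ('v \<Rightarrow>\<^sub>L complex) \<Rightarrow> complex)
    \<Rightarrow> (nat \<Rightarrow> nat) \<Rightarrow> ('v \<Rightarrow>\<^sub>L complex) \<Rightarrow> complex" where
  "psi_monomial E L z x a = (\<lambda>y.
     \<Sum>b | b \<in> multi_index (nn E) \<and> wdeg E b = wdeg E a.
       1 / of_nat (\<Prod>i<nn E. fact (b i)) *
       multi_deriv E z b (\<lambda>y'. \<Prod>i<nn E. (x i y' - x i (sec E L (prH E y'))) ^ a i) (sec E L (prH E y)) *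
       (\<Prod>i<nn E. cpair (z i) y ^ b i))"

text \<open>The \<open>F(H)\<close>-linear extension: \<open>f\<close> is expanded in the monomials of the basic invariants \<open>x\<close>.\<close>

definition psi ::
  "'v::euclidean_space elliptic_data \<Rightarrow> 'v set \<Rightarrow> (nat \<Rightarrow> 'v \<times> 'v) \<Rightarrow> (nat \<Rightarrow> ('v \<Rightarrow>\<^sub>L complex) \<Rightarrow> complex)
    \<Rightarrow> (('v \<Rightarrow>\<^sub>L complex) \<Rightarrow> complex) \<Rightarrow> ('v \<Rightarrow>\<^sub>L complex) \<Rightarrow> complex" where
  "psi E L z x f = (THE p. \<exists>A h. finite A \<and> A \<subseteq> multi_index (nn E) \<and> (\<forall>b\<in>A. h b \<in> FH E) \<and>
     f = FH_comb E A h (monomial E x) \<and> p = FH_comb E A h (psi_monomial E L z x))"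

definition linear_functions ::
  "'v::euclidean_space elliptic_data \<Rightarrow> 'v set \<Rightarrow> (('v \<Rightarrow>\<^sub>L complex) \<Rightarrow> complex) set" where
  "linear_functions E L = (\<lambda>w y. if y \<in> YY E then cpair w y else 0) ` (L \<times> L)"

text \<open>The map \<open>psi\<close> does not depend on the choice of the basic invariants \<open>x0\<close> and of the homogeneous
  basis \<open>z\<close> used to define it, so it does not matter which ones are taken.\<close>

definition good_basic_invariants ::
  "'v::euclidean_space elliptic_data \<Rightarrow> ('v \<Rightarrow> 'v) \<Rightarrow> complex \<Rightarrow> 'v set
    \<Rightarrow> (nat \<Rightarrow> ('v \<Rightarrow>\<^sub>L complex) \<Rightarrow> complex) \<Rightarrow> bool" where
  "good_basic_invariants E g \<zeta> L x \<longleftrightarrow>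
     admissible_triplet E g \<zeta> L \<and> basic_invariants E x \<and>
     (\<exists>x0 z. basic_invariants E x0 \<and> homogeneous_basis E g \<zeta> L z \<and>
        cfun_basis (nn E) x {f \<in> SW E. psi E L z x0 f \<in> linear_functions E L})"

end

theory Submission
  imports Defs "HOL-Complex_Analysis.Complex_Analysis"
begin

text \<open>
  Let \<open>y\<close> be a point of the domain and \<open>p\<close> its projection to \<open>L\<^sup>\<bottom>\<close>. For \<open>f\<close> homogeneous of degree
  \<open>0 < m \<le> d\<^sub>n\<close>, the function \<open>\<psi> f\<close> at \<open>y\<close> is the coefficient of \<open>t\<^sup>m\<close> in the expansion of \<open>f\<close> along the
  curve \<open>p + \<Sum> t^d\<^sub>i z\<^sub>i(y) \<partial>\<^sub>i\<close>: the basic invariants of degree below \<open>d\<^sub>n\<close> vanish on \<open>L\<^sup>\<bottom>\<close>, whose points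
  are fixed by the semi-simple part \<open>g\<close> of the Coxeter transformation, and subtracting from the
  top ones their value at \<open>p\<close> does not affect this coefficient. The curve depends only on \<open>L\<close> and the eigenspaces of \<open>g\<close> in \<open>L\<close>, hence so does \<open>\<psi>\<close>.

  In codimension \<open>1\<close>, the vectors of \<open>F\<close> fixed by \<open>g\<close> are those of the radical, and \<open>L \<inter> F\<close> is the
  image of \<open>g - 1\<close>. The zero type condition provides a fixed isotropic \<open>u \<in> L\<close> outside \<open>F\<close>, unique
  up to scaling and a multiple of \<open>a\<close>. So \<open>L\<close> and \<open>L'\<close> differ by a transformation
  \<open>w \<mapsto> w + s I(w, \<delta>) a\<close>. Since elements of the domain take a fixed value at \<open>a\<close>, this acts on the domain
  as a translation along the Euler field, which multiplies invariants of degree \<open>m\<close> by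
  a constant and carries the curves of \<open>L\<close> to those of \<open>L'\<close>.
\<close>

section \<open>Taylor coefficients along holomorphic curves\<close>

definition taylor_coeff :: "nat \<Rightarrow> (complex \<Rightarrow> complex) \<Rightarrow> complex" where
  "taylor_coeff m h = (deriv ^^ m) h 0 / fact m"

lemma taylor_coeff_fps:
  assumes "h holomorphic_on UNIV"
  shows "h has_fps_expansion fps_expansion h 0" and "fps_nth (fps_expansion h 0) m = taylor_coeff m h"
  using has_fps_expansion_fps_expansion[of UNIV h] assms
  by (auto simp: taylor_coeff_def fps_expansion_def)

lemma taylor_coeff_eqI:
  assumes "h has_fps_expansion H"
  shows "taylor_coeff m h = fps_nth H m"
  using fps_nth_fps_expansion[OF assms, of m] by (simp add: taylor_coeff_def)

lemma taylor_coeff_sum: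
  assumes "\<And>j. j \<in> J \<Longrightarrow> h j holomorphic_on UNIV"
  shows "taylor_coeff m (\<lambda>t. \<Sum>j\<in>J. h j t) = (\<Sum>j\<in>J. taylor_coeff m (h j))"
proof -
  have "(\<lambda>t. \<Sum>j\<in>J. h j t) has_fps_expansion (\<Sum>j\<in>J. fps_expansion (h j) 0)"
    using assms by (intro has_fps_expansion_sum taylor_coeff_fps)
  then show ?thesis
    using assms by (simp add: taylor_coeff_eqI fps_sum_nth taylor_coeff_fps(2))
qed

lemma taylor_coeff_add:
  assumes "h holomorphic_on UNIV" "k holomorphic_on UNIV"
  shows "taylor_coeff m (\<lambda>t. h t + k t) = taylor_coeff m h + taylor_coeff m k"
  using taylor_coeff_eqI[OF has_fps_expansion_add[OF assms[THEN taylor_coeff_fps(1)]], of m] assms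
  by (simp add: taylor_coeff_fps(2))

lemma taylor_coeff_cmult:
  assumes "h holomorphic_on UNIV"
  shows "taylor_coeff m (\<lambda>t. c * h t) = c * taylor_coeff m h"
  using taylor_coeff_eqI[OF has_fps_expansion_cmult_left[OF taylor_coeff_fps(1)[OF assms]], of m c] assms
  by (simp add: taylor_coeff_fps(2))

lemma taylor_coeff_const: "taylor_coeff m (\<lambda>_. c) = (if m = 0 then c else 0)"
  by (simp add: taylor_coeff_eqI[OF has_fps_expansion_const])

lemma taylor_coeff_power_mult:
  assumes "h holomorphic_on UNIV"
  shows "taylor_coeff m (\<lambda>t. t ^ k * h t) = (if m < k then 0 else taylor_coeff (m - k) h)"
  using taylor_coeff_eqI[OF has_fps_expansion_mult[OF has_fps_expansion_fps_X_power
        taylor_coeff_fps(1)[OF assms]], of m k] assms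
  by (simp add: fps_X_power_mult_nth taylor_coeff_fps(2))

text \<open>Cauchy's inequality on a circle of radius \<open>\<rho>\<close> bounds the coefficient
  by \<open>C * \<rho>\<close>, and \<open>\<rho>\<close> may tend to 0. This discards remainder
  terms below.\<close>

lemma taylor_coeff_eq_0_if_small:
  assumes h: "h holomorphic_on UNIV" and "0 < r"
    and bd: "\<And>t. norm t \<le> r \<Longrightarrow> norm (h t) \<le> C * norm t ^ Suc m"
  shows "taylor_coeff m h = 0"
proof -
  have le: "norm (taylor_coeff m h) \<le> C * \<rho>" if "0 < \<rho>" "\<rho> \<le> r" for \<rho>
  proof -
    have "norm ((deriv ^^ m) h 0) \<le> fact m * (C * \<rho> ^ Suc m) / \<rho> ^ m"
      using bd that
      by (intro Cauchy_inequality holomorphic_on_subset[OF h] holomorphic_on_imp_continuous_on) auto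
    also have "\<dots> = fact m * (C * \<rho>)" using that by simp
    finally show ?thesis by (simp add: taylor_coeff_def norm_divide field_simps)
  qed
  have "eventually (\<lambda>\<rho>. norm (taylor_coeff m h) \<le> C * \<rho>) (at_right 0)"
    using \<open>0 < r\<close> le unfolding eventually_at_right_field by force
  moreover have "((\<lambda>\<rho>. C * \<rho>) \<longlongrightarrow> C * 0) (at_right 0)" by (intro tendsto_intros)
  ultimately have "norm (taylor_coeff m h) \<le> C * 0"
    by (intro tendsto_lowerbound[where F = "at_right (0::real)"]) auto
  then show ?thesis by simp
qed

text \<open>Cauchy's inequality on the unit circle bounds every coefficient by M, so the tail is
  dominated by a geometric series, whose factor 1 / (1 - |t|) is at most 2. The bound depends on h
  only through M, hence is uniform over families of functions.\<close>

lemma taylor_remainder_bound: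
  assumes h: "h holomorphic_on UNIV" and M: "\<And>t. norm t \<le> 1 \<Longrightarrow> norm (h t) \<le> M"
    and t: "norm t \<le> 1 / 2"
  shows "norm (h t - (\<Sum>j<J. taylor_coeff j h * t ^ j)) \<le> 2 * M * norm t ^ J"
proof -
  have M0: "0 \<le> M" using order_trans[OF norm_ge_zero M[of 0]] by simp
  have c: "norm (taylor_coeff j h) \<le> M" for j
  proof -
    have "norm ((deriv ^^ j) h 0) \<le> fact j * M / 1 ^ j"
      using M by (intro Cauchy_inequality holomorphic_on_subset[OF h] holomorphic_on_imp_continuous_on) auto
    then show ?thesis by (simp add: taylor_coeff_def norm_divide field_simps)
  qed
  have "(\<lambda>j. (deriv ^^ j) h 0 / fact j * (t - 0) ^ j) sums h t"
    using t by (intro holomorphic_power_series[of _ _ 1] holomorphic_on_subset[OF h]) auto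
  then have s: "(\<lambda>j. taylor_coeff (j + J) h * t ^ (j + J)) sums (h t - (\<Sum>j<J. taylor_coeff j h * t ^ j))"
    using sums_split_initial_segment by (force simp: taylor_coeff_def)
  have g: "(\<lambda>j. M * norm t ^ J * norm t ^ j) sums (M * norm t ^ J * (1 / (1 - norm t)))"
    using t by (intro sums_mult geometric_sums) auto
  have "norm (h t - (\<Sum>j<J. taylor_coeff j h * t ^ j)) \<le> M * norm t ^ J * (1 / (1 - norm t))"
    unfolding sums_unique[OF s] sums_unique[OF g]
  proof (rule norm_suminf_le)
    show "norm (taylor_coeff (j + J) h * t ^ (j + J)) \<le> M * norm t ^ J * norm t ^ j" for j
      using mult_right_mono[OF c[of "j + J"], of "norm t ^ J * norm t ^ j"]
      by (simp add: norm_mult norm_power power_add mult_ac)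
  qed (use g in \<open>auto simp: sums_iff\<close>)
  also have "\<dots> \<le> M * norm t ^ J * 2"
    using t M0 by (intro mult_left_mono) (auto simp: field_simps)
  finally show ?thesis by (simp add: mult_ac)
qed

section \<open>Holomorphic curves in the domain and functions that are holomorphic along
  them\<close>

lemma hscale_apply [simp]: "blinfun_apply (hscale c x) u = c * blinfun_apply x u"
  by (simp add: hscale_def)

lemma hscale_simps [simp]:
  "hscale 0 x = 0" "hscale c 0 = 0" "hscale 1 x = x"
  "hscale c (x + y) = hscale c x + hscale c y" "hscale (c + d) x = hscale c x + hscale d x"
  "hscale c (hscale d x) = hscale (c * d) x"
  by (auto intro!: blinfun_eqI simp: blinfun.add_left algebra_simps)

lemma bounded_linear_hscale: "bounded_linear (\<lambda>c. hscale c x)"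
  unfolding hscale_def
  by (rule bounded_linear_compose[OF bounded_bilinear.bounded_linear_left[OF bounded_bilinear_blinfun_compose]
        bounded_linear_blinfun_mult_right])

lemma continuous_on_hscale [continuous_intros]:
  "continuous_on S f \<Longrightarrow> continuous_on S (\<lambda>u. hscale (f u) x)"
  using bounded_linear.continuous_on[OF bounded_linear_hscale] .

text \<open>The constant vector fields tangent to the fibres of the projection Y \<rightarrow> H,
  since a and \<delta> span the radical (\<open>radI_eq\<close>).\<close>

definition vertical :: "'v::euclidean_space elliptic_data \<Rightarrow> ('v \<Rightarrow>\<^sub>L complex) set" where
  "vertical E = {e. blinfun_apply e (avec E) = 0 \<and> blinfun_apply e (dvec E) = 0}"

text \<open>Complex differentiability with respect to the complex structure \<open>hscale\<close>:
  the derivative multiplies one tangent vector v by complex scalars. The condition on v says that it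
  is tangent to the affine hyperplane containing the domain.\<close>

definition hol_curve :: "'v::euclidean_space elliptic_data \<Rightarrow> (complex \<Rightarrow> 'v \<Rightarrow>\<^sub>L complex) \<Rightarrow> bool" where
  "hol_curve E \<gamma> \<longleftrightarrow> (\<forall>t. \<gamma> t \<in> YY E \<and>
     (\<exists>v. blinfun_apply v (avec E) = 0 \<and> (\<gamma> has_derivative (\<lambda>h. hscale h v)) (at t)))"

text \<open>In contrast to \<open>FY\<close>, which does not mention continuity of the differential, the following
  class is readily seen to be closed under directional derivatives, as locally uniform limits of
  difference quotients.\<close>

definition curve_hol :: "'v::euclidean_space elliptic_data \<Rightarrow> (('v \<Rightarrow>\<^sub>L complex) \<Rightarrow> complex) \<Rightarrow> bool" where
  "curve_hol E f \<longleftrightarrow> continuous_on (YY E) f \<and> (\<forall>\<gamma>. hol_curve E \<gamma> \<longrightarrow> (\<lambda>t. f (\<gamma> t)) holomorphic_on UNIV)"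

lemma YY_add_vertical: "y \<in> YY E \<Longrightarrow> e \<in> vertical E \<Longrightarrow> y + hscale t e \<in> YY E"
  by (simp add: YY_def vertical_def blinfun.add_left)

lemma hol_curve_const: "y \<in> YY E \<Longrightarrow> hol_curve E (\<lambda>_. y)"
  unfolding hol_curve_def by (auto intro!: exI[of _ 0])

lemma hol_curve_add:
  assumes "hol_curve E \<gamma>" "e \<in> vertical E" "h holomorphic_on UNIV"
  shows "hol_curve E (\<lambda>t. \<gamma> t + hscale (h t) e)"
  unfolding hol_curve_def
proof (intro allI conjI)
  fix t
  show "\<gamma> t + hscale (h t) e \<in> YY E"
    using assms by (auto simp: hol_curve_def intro: YY_add_vertical)
  obtain v where v: "blinfun_apply v (avec E) = 0" "(\<gamma> has_derivative (\<lambda>h. hscale h v)) (at t)"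
    using assms unfolding hol_curve_def by blast
  have "(h has_field_derivative deriv h t) (at t)"
    using assms(3) by (auto intro!: holomorphic_derivI[of h UNIV])
  then have "(h has_derivative (\<lambda>s. deriv h t * s)) (at t)"
    by (simp add: has_field_derivative_def)
  then have "((\<lambda>t. \<gamma> t + hscale (h t) e) has_derivative (\<lambda>s. hscale s v + hscale (deriv h t * s) e)) (at t)"
    by (intro has_derivative_add v bounded_linear.has_derivative[OF bounded_linear_hscale])
  moreover have "(\<lambda>s. hscale s v + hscale (deriv h t * s) e) = (\<lambda>s. hscale s (v + hscale (deriv h t) e))"
    by (simp add: mult.commute)
  ultimately show "\<exists>v. blinfun_apply v (avec E) = 0 \<and>
      ((\<lambda>t. \<gamma> t + hscale (h t) e) has_derivative (\<lambda>s. hscale s v)) (at t)"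
    using v(1) assms(2) by (intro exI[of _ "v + hscale (deriv h t) e"])
      (auto simp: blinfun.add_left vertical_def)
qed

lemma hol_curve_line:
  "y \<in> YY E \<Longrightarrow> e \<in> vertical E \<Longrightarrow> hol_curve E (\<lambda>t. y + hscale t e)"
  by (intro hol_curve_add hol_curve_const) auto

lemma hol_curve_continuous: "hol_curve E \<gamma> \<Longrightarrow> continuous_on S \<gamma>"
  unfolding hol_curve_def
  by (meson continuous_at_imp_continuous_on has_derivative_continuous)

lemma curve_holD: "curve_hol E f \<Longrightarrow> hol_curve E \<gamma> \<Longrightarrow> (\<lambda>t. f (\<gamma> t)) holomorphic_on UNIV"
  by (simp add: curve_hol_def)

lemma curve_hol_diff: "curve_hol E f \<Longrightarrow> curve_hol E g \<Longrightarrow> curve_hol E (\<lambda>y. f y - g y)"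
  by (auto simp: curve_hol_def intro!: continuous_intros holomorphic_intros)

lemma curve_hol_prod_power:
  "(\<And>i. i \<in> I \<Longrightarrow> curve_hol E (f i)) \<Longrightarrow> curve_hol E (\<lambda>y. \<Prod>i\<in>I. f i y ^ b i)"
  by (auto simp: curve_hol_def intro!: continuous_intros holomorphic_intros)

text \<open>The differential D is real-linear and commutes with i on tangent vectors; splitting h
  into real and imaginary part gives D (h v) = h D v. The chain rule then yields a complex
  derivative at every t.\<close>

lemma FY_curve_hol:
  assumes f: "f \<in> FY E"
  shows "curve_hol E f"
  unfolding curve_hol_def
proof (intro conjI allI impI)
  show "continuous_on (YY E) f"
    using f unfolding FY_def continuous_on_eq_continuous_within
    by (blast intro: has_derivative_continuous)
  fix \<gamma> assume \<gamma>: "hol_curve E \<gamma>"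
  have "\<exists>f'. ((\<lambda>t. f (\<gamma> t)) has_field_derivative f') (at t)" for t
  proof -
    obtain v where v: "blinfun_apply v (avec E) = 0" "(\<gamma> has_derivative (\<lambda>h. hscale h v)) (at t)"
      and y: "\<And>t. \<gamma> t \<in> YY E"
      using \<gamma> unfolding hol_curve_def by blast
    obtain D where D: "(f has_derivative D) (at (\<gamma> t) within YY E)"
      "\<And>v. blinfun_apply v (avec E) = 0 \<Longrightarrow> D (hscale \<i> v) = \<i> * D v"
      using f y unfolding FY_def by blast
    have "((\<lambda>t. f (\<gamma> t)) has_derivative (\<lambda>h. D (hscale h v))) (at t)"
      using has_derivative_in_compose[of \<gamma> "\<lambda>h. hscale h v" t UNIV f D] v(2)
        has_derivative_subset[OF D(1), of "\<gamma> ` UNIV"] y by auto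
    moreover have "D (hscale h v) = D v * h" for h
    proof -
      have "hscale h v = Re h *\<^sub>R v + Im h *\<^sub>R hscale \<i> v"
        by (intro blinfun_eqI) (simp add: blinfun.add_left blinfun.scaleR_left scaleR_conv_of_real
            complex_eq_iff)
      then show ?thesis
        using has_derivative_linear[OF D(1)] D(2)[OF v(1)]
        by (simp add: linear_add linear_scale scaleR_conv_of_real complex_eq_iff)
    qed
    ultimately show ?thesis
      by (intro exI[of _ "D v"]) (simp add: has_field_derivative_def)
  qed
  then show "(\<lambda>t. f (\<gamma> t)) holomorphic_on UNIV"
    by (auto simp: holomorphic_on_open)
qed

section \<open>Directional derivatives along vertical vectors\<close>

lemma dir_deriv_power_line:
  "(dir_deriv e ^^ j) f (y + hscale t e) = (deriv ^^ j) (\<lambda>s. f (y + hscale s e)) t"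
proof (induction j arbitrary: t)
  case (Suc j)
  have "(dir_deriv e ^^ Suc j) f (y + hscale t e)
      = deriv (\<lambda>s. (dir_deriv e ^^ j) f (y + hscale (t + s) e)) 0"
    by (simp add: dir_deriv_def add.assoc)
  also have "\<dots> = deriv (\<lambda>s. (deriv ^^ j) (\<lambda>s. f (y + hscale s e)) (s + t)) 0"
    by (simp only: Suc add.commute)
  \<comment> \<open>No differentiability is required: \<open>deriv\<close> selects among the
    possible derivatives, and these are the same for the shifted function at 0 and the original one
    at t.\<close>
  also have "\<dots> = deriv ((deriv ^^ j) (\<lambda>s. f (y + hscale s e))) t"
    using DERIV_shift[of "(deriv ^^ j) (\<lambda>s. f (y + hscale s e))" _ 0 t]
    by (simp add: deriv_def[of _ 0] deriv_def[of _ t])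
  finally show ?case by simp
qed simp

lemma taylor_coeff_line:
  "taylor_coeff j (\<lambda>t. f (y + hscale t e)) = (dir_deriv e ^^ j) f y / fact j"
  using dir_deriv_power_line[of j e f y 0] by (simp add: taylor_coeff_def)

text \<open>The closed unit discs in direction e around the points of K fill a compact part of the
  domain, on which f is bounded. So one constant serves all q in K and all orders J.\<close>

lemma taylor_bound:
  assumes f: "curve_hol E f" and e: "e \<in> vertical E" and K: "compact K" "K \<subseteq> YY E"
  obtains C where "0 \<le> C" "\<And>q t J. q \<in> K \<Longrightarrow> norm t \<le> 1 / 2 \<Longrightarrow>
    norm (f (q + hscale t e) - (\<Sum>j<J. (dir_deriv e ^^ j) f q / fact j * t ^ j)) \<le> C * norm t ^ J"
proof -
  let ?K = "(\<lambda>(q, t). q + hscale t e) ` (K \<times> cball 0 1)"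
  have "compact ?K"
    using K by (intro compact_continuous_image compact_Times)
      (auto simp: case_prod_unfold intro!: continuous_intros)
  moreover have "?K \<subseteq> YY E"
    using K e by (auto intro: YY_add_vertical)
  ultimately have "compact (f ` ?K)"
    using f by (intro compact_continuous_image[of ?K f])
      (auto simp: curve_hol_def intro: continuous_on_subset)
  then have "bounded (f ` ?K)" by (rule compact_imp_bounded)
  then obtain M where M: "\<And>y. y \<in> ?K \<Longrightarrow> norm (f y) \<le> M"
    unfolding bounded_iff by blast
  show ?thesis
  \<comment> \<open>The factor 2 comes from \<open>taylor_remainder_bound\<close>; the maximum with
    0 keeps the constant nonnegative even when K is empty.\<close>
  proof (rule that[of "2 * max M 0"])
    fix q and t :: complex and J assume q: "q \<in> K" and t: "norm t \<le> 1 / 2"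
    have "(\<lambda>t. f (q + hscale t e)) holomorphic_on UNIV"
      using q K e by (intro curve_holD[OF f] hol_curve_line) auto
    moreover have "norm (f (q + hscale t e)) \<le> max M 0" if "norm t \<le> 1" for t
      using M[of "q + hscale t e"] q that by force
    ultimately show "norm (f (q + hscale t e) - (\<Sum>j<J. (dir_deriv e ^^ j) f q / fact j * t ^ j))
        \<le> 2 * max M 0 * norm t ^ J"
      using taylor_remainder_bound[of "\<lambda>t. f (q + hscale t e)" "max M 0" t J] t
      by (simp add: taylor_coeff_line)
  qed simp
qed

text \<open>The Taylor bound of order 2, divided by the step of the difference quotient, leaves an
  error of the size of the step, uniformly on K.\<close>

lemma dir_deriv_uniform_limit:
  assumes f: "curve_hol E f" and e: "e \<in> vertical E" and K: "compact K" "K \<subseteq> YY E"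
  shows "uniform_limit K (\<lambda>k y. (f (y + hscale (1 / of_nat (Suc (Suc k))) e) - f y) * of_nat (Suc (Suc k)))
     (dir_deriv e f) sequentially"
proof -
  obtain C where C: "0 \<le> C" "\<And>q t J. q \<in> K \<Longrightarrow> norm t \<le> 1 / 2 \<Longrightarrow>
    norm (f (q + hscale t e) - (\<Sum>j<J. (dir_deriv e ^^ j) f q / fact j * t ^ j)) \<le> C * norm t ^ J"
    using taylor_bound[OF assms] by blast
  have est: "dist ((f (y + hscale (1 / of_nat (Suc (Suc k))) e) - f y) * of_nat (Suc (Suc k))) (dir_deriv e f y)
      \<le> C * inverse (real (Suc (Suc k)))" if y: "y \<in> K" for y k
  proof -
    \<comment> \<open>The steps 1 / (k + 2) never exceed 1/2, the radius in which
      \<open>taylor_bound\<close> is valid.\<close>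
    define n where "n = Suc (Suc k)"
    have n: "2 \<le> n" by (simp add: n_def)
    let ?t = "1 / of_nat n :: complex"
    have "norm (f (y + hscale ?t e) - f y - dir_deriv e f y * ?t) \<le> C * norm ?t ^ 2"
    proof -
      have "norm ?t \<le> 1 / 2" using n by (simp add: norm_divide)
      moreover have "(\<Sum>j<2. (dir_deriv e ^^ j) f y / fact j * ?t ^ j) = f y + dir_deriv e f y * ?t"
        by (simp add: numeral_2_eq_2)
      ultimately show ?thesis
        using C(2)[OF y, of ?t 2] by (simp only: diff_diff_eq)
    qed
    then have "norm (f (y + hscale ?t e) - f y - dir_deriv e f y * ?t) * n \<le> C * norm ?t ^ 2 * n"
      by (intro mult_right_mono) auto
    also have "\<dots> = C * inverse n" using n by (simp add: norm_divide power2_eq_square field_simps)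
    also have "norm (f (y + hscale ?t e) - f y - dir_deriv e f y * ?t) * n
        = norm ((f (y + hscale ?t e) - f y - dir_deriv e f y * ?t) * of_nat n)"
      by (simp add: norm_mult)
    also have "(f (y + hscale ?t e) - f y - dir_deriv e f y * ?t) * of_nat n
        = (f (y + hscale ?t e) - f y) * of_nat n - dir_deriv e f y"
      using n by (simp add: algebra_simps)
    finally show ?thesis by (simp add: dist_norm n_def)
  qed
  have "(\<lambda>k. C * inverse (real (Suc (Suc k)))) \<longlonglongrightarrow> C * 0"
    by (intro tendsto_mult tendsto_const LIMSEQ_Suc[OF LIMSEQ_inverse_real_of_nat])
  then have lim: "(\<lambda>k. C * inverse (real (Suc (Suc k)))) \<longlonglongrightarrow> 0" by simp
  show ?thesis
    unfolding uniform_limit_iff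
  proof (intro allI impI)
    fix \<epsilon> :: real assume "0 < \<epsilon>"
    from order_tendstoD(2)[OF lim this]
    show "\<forall>\<^sub>F k in sequentially. \<forall>y\<in>K. dist ((f (y + hscale (1 / of_nat (Suc (Suc k))) e) - f y) *
        of_nat (Suc (Suc k))) (dir_deriv e f y) < \<epsilon>"
      by eventually_elim (use est in \<open>auto intro: le_less_trans\<close>)
  qed
qed

text \<open>The domain is the part of a closed affine hyperplane lying in an open half-space; a
  closed ball inside the half-space meets it in a compact set.\<close>

lemma YY_locally_compact:
  assumes "y \<in> YY E"
  obtains r where "0 < r" "compact (YY E \<inter> cball y r)"
proof -
  have cont: "continuous_on UNIV (\<lambda>x :: 'a \<Rightarrow>\<^sub>L complex. blinfun_apply x u)" for u
    by (intro continuous_intros)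
  have "open {x :: 'a \<Rightarrow>\<^sub>L complex. 0 < Re (blinfun_apply x (dvec E))}"
    by (intro open_Collect_less continuous_intros)
  moreover have "y \<in> {x. 0 < Re (blinfun_apply x (dvec E))}" using assms by (simp add: YY_def)
  ultimately obtain r where r: "0 < r" "cball y r \<subseteq> {x. 0 < Re (blinfun_apply x (dvec E))}"
    using open_contains_cball by metis
  have eq: "YY E \<inter> cball y r = cball y r \<inter> {x. blinfun_apply x (avec E) = - 2 * of_real pi * \<i>}"
    using r by (auto simp: YY_def)
  have "closed {x :: 'a \<Rightarrow>\<^sub>L complex. blinfun_apply x (avec E) = - 2 * of_real pi * \<i>}"
    by (intro closed_Collect_eq continuous_intros)
  then have "compact (YY E \<inter> cball y r)"
    unfolding eq by (intro compact_Int_closed compact_cball)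
  with r show ?thesis using that by blast
qed

text \<open>Both properties pass to uniform limits of difference quotients: continuity on a compact
  neighbourhood of each point, holomorphy on the image under the curve of each closed unit
  disc.\<close>

lemma curve_hol_dir_deriv:
  assumes f: "curve_hol E f" and e: "e \<in> vertical E"
  shows "curve_hol E (dir_deriv e f)"
  unfolding curve_hol_def
proof (intro conjI allI impI)
  let ?q = "\<lambda>k y. (f (y + hscale (1 / of_nat (Suc (Suc k))) e) - f y) * of_nat (Suc (Suc k))"
  have shift: "continuous_on (YY E) (\<lambda>y. f (y + hscale t e))" for t
  proof (rule continuous_on_compose2[of "YY E" f])
    show "continuous_on (YY E) f" using f by (simp add: curve_hol_def)
    show "continuous_on (YY E) (\<lambda>y. y + hscale t e)" by (intro continuous_on_add continuous_on_id continuous_on_const)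
    show "(\<lambda>y. y + hscale t e) ` YY E \<subseteq> YY E" using YY_add_vertical[OF _ e] by blast
  qed
  show "continuous_on (YY E) (dir_deriv e f)"
    unfolding continuous_on_eq_continuous_within
  proof
    fix y assume y: "y \<in> YY E"
    then obtain r where r: "0 < r" "compact (YY E \<inter> cball y r)" by (rule YY_locally_compact)
    have "continuous_on (YY E \<inter> cball y r) (dir_deriv e f)"
    proof (rule uniform_limit_theorem[OF _ dir_deriv_uniform_limit[OF f e r(2)]])
      have "continuous_on (YY E) (?q k)" for k
        using f by (intro continuous_on_mult continuous_on_diff continuous_on_const shift) (simp add: curve_hol_def)
      then show "\<forall>\<^sub>F k in sequentially. continuous_on (YY E \<inter> cball y r) (?q k)"
        by (intro always_eventually allI) (rule continuous_on_subset[of "YY E"], auto)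
    qed auto
    then have "continuous (at y within (YY E \<inter> cball y r)) (dir_deriv e f)"
      using y r by (auto simp: continuous_on_eq_continuous_within)
    moreover have "at y within (YY E \<inter> cball y r) = at y within YY E"
      using r by (intro at_within_nhd[of _ "ball y r"]) auto
    ultimately show "continuous (at y within YY E) (dir_deriv e f)" by simp
  qed
  fix \<gamma> assume \<gamma>: "hol_curve E \<gamma>"
  show "(\<lambda>t. dir_deriv e f (\<gamma> t)) holomorphic_on UNIV"
  proof (rule holomorphic_uniform_sequence[of _ "\<lambda>k t. ?q k (\<gamma> t)"])
    show "(\<lambda>t. ?q k (\<gamma> t)) holomorphic_on UNIV" for k
      by (intro holomorphic_on_mult holomorphic_on_diff holomorphic_on_const
          curve_holD[OF f hol_curve_add[OF \<gamma> e]] curve_holD[OF f \<gamma>])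
    fix t :: complex
    have "compact (\<gamma> ` cball t 1)" "\<gamma> ` cball t 1 \<subseteq> YY E"
      by (rule compact_continuous_image[OF hol_curve_continuous[OF \<gamma>] compact_cball])
        (use \<gamma> in \<open>auto simp: hol_curve_def\<close>)
    from dir_deriv_uniform_limit[OF f e this]
    have "uniform_limit (cball t 1) (\<lambda>k t. ?q k (\<gamma> t)) (\<lambda>t. dir_deriv e f (\<gamma> t)) sequentially"
      by (rule uniform_limit_compose') auto
    then show "\<exists>d>0. cball t d \<subseteq> UNIV \<and>
        uniform_limit (cball t d) (\<lambda>k t. ?q k (\<gamma> t)) (\<lambda>t. dir_deriv e f (\<gamma> t)) sequentially"
      by (intro exI[of _ 1]) auto
  qed auto
qed

lemma curve_hol_dir_deriv_power:
  "curve_hol E f \<Longrightarrow> e \<in> vertical E \<Longrightarrow> curve_hol E ((dir_deriv e ^^ j) f)"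
  by (induction j) (auto intro: curve_hol_dir_deriv)

text \<open>Expand f at the moving point \<open>\<gamma> t\<close> in direction e and insert the
  step t^d s: the j-th term carries the factor t^(d j). After m + 1 terms the remainder is
  O(t^(m+1)), uniformly because \<open>\<gamma>\<close> maps the unit disc to a compact set, so it
  does not reach the coefficient of t^m.\<close>

lemma taylor_coeff_step:
  assumes f: "curve_hol E f" and \<gamma>: "hol_curve E \<gamma>" and e: "e \<in> vertical E" and d: "0 < d"
  shows "taylor_coeff m (\<lambda>t. f (\<gamma> t + hscale (t ^ d * s) e)) =
    (\<Sum>j | d * j \<le> m. s ^ j / fact j * taylor_coeff (m - d * j) (\<lambda>t. (dir_deriv e ^^ j) f (\<gamma> t)))"
proof -
  let ?D = "\<lambda>j t. (dir_deriv e ^^ j) f (\<gamma> t)"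
  let ?S = "\<lambda>t. \<Sum>j<Suc m. s ^ j / fact j * (t ^ (d * j) * ?D j t)"
  define h where "h = (\<lambda>t. f (\<gamma> t + hscale (t ^ d * s) e) - ?S t)"
  have D: "?D j holomorphic_on UNIV" for j
    by (rule curve_holD[OF curve_hol_dir_deriv_power[OF f e] \<gamma>])
  have tD: "(\<lambda>t. t ^ (d * j) * ?D j t) holomorphic_on UNIV" for j
    by (intro holomorphic_on_mult D holomorphic_on_power holomorphic_on_ident)
  have S: "?S holomorphic_on UNIV"
    by (intro holomorphic_on_sum holomorphic_on_mult[OF holomorphic_on_const] tD)
  have fh: "(\<lambda>t. f (\<gamma> t + hscale (t ^ d * s) e)) holomorphic_on UNIV"
    by (rule curve_holD[OF f hol_curve_add[OF \<gamma> e]]) (intro holomorphic_intros)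
  have h: "h holomorphic_on UNIV"
    unfolding h_def by (intro holomorphic_on_diff S fh)
  have "compact (\<gamma> ` cball 0 1)" "\<gamma> ` cball 0 1 \<subseteq> YY E"
    by (rule compact_continuous_image[OF hol_curve_continuous[OF \<gamma>] compact_cball])
      (use \<gamma> in \<open>auto simp: hol_curve_def\<close>)
  from taylor_bound[OF f e this] obtain C where C: "0 \<le> C"
    "\<And>q t J. q \<in> \<gamma> ` cball 0 1 \<Longrightarrow> norm t \<le> 1 / 2 \<Longrightarrow>
      norm (f (q + hscale t e) - (\<Sum>j<J. (dir_deriv e ^^ j) f q / fact j * t ^ j)) \<le> C * norm t ^ J"
    by blast
  \<comment> \<open>For |t| \<le> r, the point \<open>\<gamma> t\<close> lies in the compact set and
    |t^d s| \<le> 1/2, as the Taylor bound demands.\<close>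
  define r where "r = 1 / (2 * (1 + norm s))"
  have "0 < 1 + norm s" by (simp add: add_pos_nonneg)
  then have r: "0 < r" "r \<le> 1" "r * norm s \<le> 1 / 2"
    by (auto simp: r_def field_simps)
  have "taylor_coeff m h = 0"
  proof (rule taylor_coeff_eq_0_if_small[OF h r(1)])
    fix t :: complex assume t: "norm t \<le> r"
    have "norm t ^ d \<le> norm t ^ 1"
      using t r d by (intro power_decreasing) auto
    then have ts: "norm (t ^ d * s) \<le> norm t * norm s"
      by (simp add: norm_mult norm_power mult_right_mono)
    also have "\<dots> \<le> r * norm s" using t by (intro mult_right_mono) auto
    finally have half: "norm (t ^ d * s) \<le> 1 / 2" using r by linarith
    have "h t = f (\<gamma> t + hscale (t ^ d * s) e) - (\<Sum>j<Suc m. ?D j t / fact j * (t ^ d * s) ^ j)"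
    proof -
      have "(t ^ d * s) ^ j = s ^ j * t ^ (d * j)" for j
        by (simp add: power_mult_distrib power_mult)
      then show ?thesis unfolding h_def by (simp add: mult_ac del: sum.lessThan_Suc)
    qed
    also have "norm \<dots> \<le> C * norm (t ^ d * s) ^ Suc m"
      using t r half by (intro C(2)) auto
    also have "\<dots> \<le> C * (norm t * norm s) ^ Suc m"
      using C(1) ts by (intro mult_left_mono power_mono) auto
    finally show "norm (h t) \<le> (C * norm s ^ Suc m) * norm t ^ Suc m"
      by (simp add: power_mult_distrib mult_ac)
  qed
  then have "taylor_coeff m (\<lambda>t. f (\<gamma> t + hscale (t ^ d * s) e)) = taylor_coeff m ?S"
    using taylor_coeff_add[OF h S, of m] by (simp add: h_def)
  also have "\<dots> = (\<Sum>j<Suc m. s ^ j / fact j * taylor_coeff m (\<lambda>t. t ^ (d * j) * ?D j t))"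
    by (subst taylor_coeff_sum, rule holomorphic_on_mult[OF holomorphic_on_const tD])
      (rule sum.cong[OF refl taylor_coeff_cmult[OF tD]])
  also have "\<dots> = (\<Sum>j<Suc m. if d * j \<le> m then s ^ j / fact j * taylor_coeff (m - d * j) (?D j) else 0)"
    using D by (intro sum.cong refl) (auto simp: taylor_coeff_power_mult)
  also have "\<dots> = (\<Sum>j\<in>{j \<in> {..<Suc m}. d * j \<le> m}. s ^ j / fact j * taylor_coeff (m - d * j) (?D j))"
    by (intro sum.inter_filter[symmetric]) auto
  also have "{j \<in> {..<Suc m}. d * j \<le> m} = {j. d * j \<le> m}"
  proof -
    have "j \<le> m" if "d * j \<le> m" for j
      using that d by (cases d) auto
    then show ?thesis by (auto simp: less_Suc_eq_le)
  qed
  finally show ?thesis .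
qed

text \<open>Positive weights bound each entry by m. Sums over infinite sets are 0 by convention, so
  finiteness is what permits the rearrangement in \<open>taylor_coeff_multi\<close>.\<close>

lemma finite_multi_index_weight:
  assumes "\<And>i. i < n \<Longrightarrow> 0 < (d i :: nat)"
  shows "finite {b \<in> multi_index n. (\<Sum>i<n. d i * b i) = m}"
proof (rule finite_subset)
  show "finite {b. \<forall>i. (i \<in> {..<n} \<longrightarrow> b i \<in> {..m}) \<and> (i \<notin> {..<n} \<longrightarrow> b i = 0)}"
    by (intro finite_set_of_finite_funs) auto
  show "{b \<in> multi_index n. (\<Sum>i<n. d i * b i) = m}
      \<subseteq> {b. \<forall>i. (i \<in> {..<n} \<longrightarrow> b i \<in> {..m}) \<and> (i \<notin> {..<n} \<longrightarrow> b i = 0)}"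
  proof (clarsimp simp: multi_index_def)
    fix b :: "nat \<Rightarrow> nat" and i assume i: "i < n"
    have "b i \<le> d i * b i" using assms[OF i] by simp
    also have "\<dots> \<le> (\<Sum>i<n. d i * b i)" using i by (intro member_le_sum) auto
    finally show "b i \<le> (\<Sum>i<n. d i * b i)" .
  qed
qed

text \<open>Induction on the number of directions: the first n of them form a holomorphic curve, to
  which \<open>taylor_coeff_step\<close> adds the last one. The right-hand side has the shape of
  \<open>psi_monomial\<close>.\<close>

lemma taylor_coeff_multi:
  assumes f: "curve_hol E f" and p: "p \<in> YY E"
    and "\<And>i. i < n \<Longrightarrow> e i \<in> vertical E" and "\<And>i. i < n \<Longrightarrow> 0 < d i"
  shows "taylor_coeff m (\<lambda>t. f (p + (\<Sum>i<n. hscale (t ^ d i * s i) (e i)))) =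
    (\<Sum>b | b \<in> multi_index n \<and> (\<Sum>i<n. d i * b i) = m.
       1 / of_nat (\<Prod>i<n. fact (b i)) *
       foldr (\<lambda>i G. (dir_deriv (e i) ^^ b i) \<circ> G) [0..<n] id f p * (\<Prod>i<n. s i ^ b i))"
  using f assms(3,4)
proof (induction n arbitrary: f m)
  case 0
  have "{b. b \<in> multi_index 0 \<and> (\<Sum>i<0. d i * b i) = m} = (if m = 0 then {\<lambda>_. 0} else {})"
    by (auto simp: multi_index_def)
  then show ?case by (simp add: taylor_coeff_const)
next
  case (Suc n)
  define D where "D b f = foldr (\<lambda>i G. (dir_deriv (e i) ^^ b i) \<circ> G) [0..<n] id f p" for b f
  let ?B = "\<lambda>m. {b. b \<in> multi_index n \<and> (\<Sum>i<n. d i * b i) = m}"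
  \<comment> \<open>The last index gives the innermost derivative of the fold, which acts on f first
    and can be absorbed into the function.\<close>
  have fr: "foldr (\<lambda>i G. (dir_deriv (e i) ^^ b i) \<circ> G) xs (F \<circ> id) f
      = foldr (\<lambda>i G. (dir_deriv (e i) ^^ b i) \<circ> G) xs id (F f)" for b xs F f
    by (induction xs) auto
  have curve: "hol_curve E (\<lambda>t. p + (\<Sum>i<k. hscale (t ^ d i * s i) (e i)))" if "k \<le> n" for k
    using that
  proof (induction k)
    case 0 then show ?case using hol_curve_const[OF p] by simp
  next
    case (Suc k)
    then have "hol_curve E (\<lambda>t. (p + (\<Sum>i<k. hscale (t ^ d i * s i) (e i))) + hscale (t ^ d k * s k) (e k))"
      using Suc.prems \<open>\<And>i. i < Suc n \<Longrightarrow> e i \<in> vertical E\<close>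
      by (intro hol_curve_add) (auto intro!: holomorphic_intros)
    then show ?case by (simp add: add.assoc)
  qed
  have cong: "foldr (\<lambda>i G. (dir_deriv (e i) ^^ (b(n := j)) i) \<circ> G) [0..<n] id f p = D b f" for b j f
    unfolding D_def by (rule arg_cong[of _ _ "\<lambda>G. G f p"], rule foldr_cong) auto
  have "taylor_coeff m (\<lambda>t. f (p + (\<Sum>i<Suc n. hscale (t ^ d i * s i) (e i))))
      = taylor_coeff m (\<lambda>t. f ((p + (\<Sum>i<n. hscale (t ^ d i * s i) (e i))) + hscale (t ^ d n * s n) (e n)))"
    by (simp add: add.assoc)
  also have "\<dots> = (\<Sum>j | d n * j \<le> m. s n ^ j / fact j *
      taylor_coeff (m - d n * j) (\<lambda>t. (dir_deriv (e n) ^^ j) f (p + (\<Sum>i<n. hscale (t ^ d i * s i) (e i)))))"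
    using Suc.prems by (intro taylor_coeff_step[OF Suc.prems(1) curve[OF order_refl]]) auto
  also have "\<dots> = (\<Sum>j | d n * j \<le> m. s n ^ j / fact j * (\<Sum>b\<in>?B (m - d n * j).
       1 / of_nat (\<Prod>i<n. fact (b i)) * D b ((dir_deriv (e n) ^^ j) f) * (\<Prod>i<n. s i ^ b i)))"
    unfolding D_def using Suc.prems
    by (intro sum.cong refl arg_cong2[of _ _ _ _ times] Suc.IH curve_hol_dir_deriv_power) auto
  also have "\<dots> = (\<Sum>j | d n * j \<le> m. \<Sum>b\<in>?B (m - d n * j). s n ^ j / fact j * (
       1 / of_nat (\<Prod>i<n. fact (b i)) * D b ((dir_deriv (e n) ^^ j) f) * (\<Prod>i<n. s i ^ b i)))"
    by (simp only: sum_distrib_left)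
  also have "\<dots> = (\<Sum>(j, b)\<in>(SIGMA j:{j. d n * j \<le> m}. ?B (m - d n * j)). s n ^ j / fact j * (
       1 / of_nat (\<Prod>i<n. fact (b i)) * D b ((dir_deriv (e n) ^^ j) f) * (\<Prod>i<n. s i ^ b i)))"
  proof (rule sum.Sigma)
    have "j \<le> m" if "d n * j \<le> m" for j
      using that Suc.prems(3)[of n] by (cases "d n") auto
    then have "{j. d n * j \<le> m} \<subseteq> {..m}" by auto
    then show "finite {j. d n * j \<le> m}" by (rule finite_subset) auto
    show "\<forall>j\<in>{j. d n * j \<le> m}. finite (?B (m - d n * j))"
      using finite_multi_index_weight[of n d] Suc.prems by auto
  qed
  also have "\<dots> = (\<Sum>b | b \<in> multi_index (Suc n) \<and> (\<Sum>i<Suc n. d i * b i) = m.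
       1 / of_nat (\<Prod>i<Suc n. fact (b i)) *
       foldr (\<lambda>i G. (dir_deriv (e i) ^^ b i) \<circ> G) [0..<Suc n] id f p * (\<Prod>i<Suc n. s i ^ b i))"
  \<comment> \<open>A multi-index of length n + 1 is its entry j at n together with a multi-index of
    length n, whose entry at n is 0 by definition of \<open>multi_index\<close>.\<close>
  proof (rule sum.reindex_bij_witness[where i = "\<lambda>b. (b n, b(n := 0))" and j = "\<lambda>(j, b). b(n := j)"])
    fix w assume "w \<in> (SIGMA j:{j. d n * j \<le> m}. ?B (m - d n * j))"
    then obtain j b where w: "w = (j, b)" "d n * j \<le> m" "b \<in> multi_index n" "(\<Sum>i<n. d i * b i) = m - d n * j"
      by auto
    then have "b n = 0" by (simp add: multi_index_def)
    then show "((case w of (j, b) \<Rightarrow> b(n := j)) n, (case w of (j, b) \<Rightarrow> b(n := j))(n := 0)) = w"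
      by (auto simp: w fun_eq_iff)
    show "(case w of (j, b) \<Rightarrow> b(n := j)) \<in> {b. b \<in> multi_index (Suc n) \<and> (\<Sum>i<Suc n. d i * b i) = m}"
      using w by (auto simp: multi_index_def)
    show "1 / of_nat (\<Prod>i<Suc n. fact ((case w of (j, b) \<Rightarrow> b(n := j)) i)) *
       foldr (\<lambda>i G. (dir_deriv (e i) ^^ (case w of (j, b) \<Rightarrow> b(n := j)) i) \<circ> G) [0..<Suc n] id f p *
       (\<Prod>i<Suc n. s i ^ (case w of (j, b) \<Rightarrow> b(n := j)) i) =
       (case w of (j, b) \<Rightarrow> s n ^ j / fact j * (
       1 / of_nat (\<Prod>i<n. fact (b i)) * D b ((dir_deriv (e n) ^^ j) f) * (\<Prod>i<n. s i ^ b i)))"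
    proof -
      have *: "foldr (\<lambda>i G. (dir_deriv (e i) ^^ (b(n := j)) i) \<circ> G) [0..<Suc n] id f p
        = D b ((dir_deriv (e n) ^^ j) f)"
        using fr[of "b(n := j)" "[0..<n]" "dir_deriv (e n) ^^ j" f] cong[of b j "(dir_deriv (e n) ^^ j) f"]
        by simp
      show ?thesis unfolding w prod.case * by (simp add: mult_ac)
    qed
  next
    fix b assume "b \<in> {b. b \<in> multi_index (Suc n) \<and> (\<Sum>i<Suc n. d i * b i) = m}"
    then have b: "b \<in> multi_index (Suc n)" "(\<Sum>i<n. d i * b i) + d n * b n = m" by auto
    show "(case (b n, b(n := 0)) of (j, b) \<Rightarrow> b(n := j)) = b" by simp
    show "(b n, b(n := 0)) \<in> (SIGMA j:{j. d n * j \<le> m}. ?B (m - d n * j))"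
      using b by (auto simp: multi_index_def le_Suc_eq)
  qed
  finally show ?case .
qed

section \<open>Linear algebra of marked elliptic root systems\<close>

lemma map_prod_cscale:
  assumes "linear g"
  shows "map_prod g g (cscale c w) = cscale c (map_prod g g w)"
  using assms by (cases w) (simp add: cscale_def linear_diff linear_add linear_scale)

lemma map_prod_add:
  assumes "linear g"
  shows "map_prod g g (v + w) = map_prod g g v + map_prod g g w"
  using assms by (cases v; cases w) (simp add: linear_add)

lemma map_prod_lincomb:
  assumes "linear g"
  shows "map_prod g g (\<Sum>i\<in>I. cscale (c i) (z i)) = (\<Sum>i\<in>I. cscale (c i) (map_prod g g (z i)))"
proof (induction I rule: infinite_finite_induct)
  case (insert i I)
  then show ?case by (simp add: map_prod_add[OF assms] map_prod_cscale[OF assms])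
qed (use assms in \<open>auto simp: zero_prod_def linear_0\<close>)

lemma cpair_simps [simp]:
  "cpair (v + w) x = cpair v x + cpair w x" "cpair 0 x = 0" "cpair (cscale c w) x = c * cpair w x"
  "cpair w (x + y) = cpair w x + cpair w y" "cpair w 0 = 0" "cpair w (hscale c x) = c * cpair w x"
  by (simp_all add: cpair_def cscale_def blinfun.add_right blinfun.add_left blinfun.diff_right
      blinfun.scaleR_right blinfun.zero_left blinfun.zero_right algebra_simps)
    (simp add: complex_eq_iff algebra_simps)

lemma cpair_sum:
  "cpair (\<Sum>i\<in>I. f i) x = (\<Sum>i\<in>I. cpair (f i) x)" "cpair w (\<Sum>i\<in>I. g i) = (\<Sum>i\<in>I. cpair w (g i))"
  by (induction I rule: infinite_finite_induct) auto

lemma cvec_basis_expand: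
  assumes "cvec_basis n z V" "w \<in> V"
  obtains c where "w = (\<Sum>i<n. cscale (c i) (z i))"
proof -
  have "w \<in> cvec.span (z ` {..<n})" using assms by (simp add: cvec_basis_def)
  then obtain u where "w = (\<Sum>v\<in>z ` {..<n}. cscale (u v) v)"
    by (auto simp: cvec.span_finite)
  also have "\<dots> = (\<Sum>i<n. cscale (u (z i)) (z i))"
    using assms by (simp add: sum.reindex cvec_basis_def)
  finally show ?thesis by (rule that)
qed

lemma cvec_basis_coeff_0:
  assumes "cvec_basis n z V" "(\<Sum>i<n. cscale (c i) (z i)) = 0" "i < n"
  shows "c i = 0"
proof -
  have inj: "inj_on z {..<n}" using assms by (simp add: cvec_basis_def)
  let ?u = "\<lambda>v. c (the_inv_into {..<n} z v)"
  have "(\<Sum>v\<in>z ` {..<n}. cscale (?u v) v) = (\<Sum>i<n. cscale (c i) (z i))"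
    using inj by (simp add: sum.reindex the_inv_into_f_f)
  then have "?u (z i) = 0"
    using assms by (intro cvec.independentD[of "z ` {..<n}"]) (auto simp: cvec_basis_def)
  then show ?thesis using inj assms(3) by (simp add: the_inv_into_f_f)
qed

lemma cvec_basis_mem: "cvec_basis n z V \<Longrightarrow> i < n \<Longrightarrow> z i \<in> V"
  using cvec.span_base[of "z i" "z ` {..<n}"] by (simp add: cvec_basis_def)

text \<open>The exponents run through 1, ..., N instead of 0, ..., N - 1 to match the degrees; since
  the smaller exponent is positive, the difference is still below N.\<close>

lemma primitive_root_power_inj:
  assumes "primitive_root N \<zeta>" "0 < i" "i \<le> N" "0 < j" "j \<le> N" "\<zeta> ^ i = \<zeta> ^ j"
  shows "i = j"
  using assms(2-)
proof (induction i j rule: linorder_wlog)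
  case (le i j)
  have "\<zeta> \<noteq> 0" using assms(1) by (auto simp: primitive_root_def zero_power)
  have "\<zeta> ^ j = \<zeta> ^ i * \<zeta> ^ (j - i)" using le by (metis le_add_diff_inverse power_add)
  then have "\<zeta> ^ (j - i) = 1" using le \<open>\<zeta> \<noteq> 0\<close> by simp
  show ?case
  proof (rule ccontr)
    assume "i \<noteq> j"
    then have "0 < j - i" "j - i < N" using le by auto
    with \<open>\<zeta> ^ (j - i) = 1\<close> assms(1) show False by (auto simp: primitive_root_def)
  qed
qed simp

text \<open>Compare the coefficients of g w and \<mu> w in the eigenbasis. An eigenvector thus
  involves only basis vectors of its own eigenvalue.\<close>

lemma homogeneous_basis_eigenvector_coeff:
  assumes z: "homogeneous_basis E g \<zeta> L z" and g: "linear g"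
    and w: "w = (\<Sum>i<nn E. cscale (c i) (z i))" and eig: "map_prod g g w = cscale \<mu> w" and i: "i < nn E"
  shows "c i = 0 \<or> \<zeta> ^ deg E i = \<mu>"
proof -
  have "(\<Sum>i<nn E. cscale (c i) (cscale (\<zeta> ^ deg E i) (z i))) = map_prod g g w"
    unfolding w map_prod_lincomb[OF g] using z by (auto simp: homogeneous_basis_def)
  also have "\<dots> = (\<Sum>i<nn E. cscale (\<mu> * c i) (z i))"
    unfolding eig unfolding w by (simp add: cvec.scale_sum_right del: sum.lessThan_Suc)
  finally have "(\<Sum>i<nn E. cscale (c i * \<zeta> ^ deg E i - \<mu> * c i) (z i)) = 0"
    by (simp add: cvec.scale_left_diff_distrib sum_subtractf mult.commute del: sum.lessThan_Suc)
  then have "c i * \<zeta> ^ deg E i - \<mu> * c i = 0"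
    using z i by (intro cvec_basis_coeff_0[of "nn E" z "L \<times> L" _ i]) (auto simp: homogeneous_basis_def)
  then show ?thesis by (auto simp: algebra_simps)
qed

section \<open>The form, the radical and the Euler field\<close>

locale marked_elliptic =
  fixes E :: "'v::euclidean_space elliptic_data"
  assumes marked: "marked_elliptic_root_system E"
begin

abbreviation II where "II \<equiv> Form E"
abbreviation \<delta> where "\<delta> \<equiv> dvec E"
abbreviation aa where "aa \<equiv> avec E"

lemma Form_bilinear: "bilinear II"
  using marked by (simp add: marked_elliptic_root_system_def)

lemmas Form_simps = bilinear_ladd[OF Form_bilinear] bilinear_radd[OF Form_bilinear]
  bilinear_lmul[OF Form_bilinear] bilinear_rmul[OF Form_bilinear]
  bilinear_lsub[OF Form_bilinear] bilinear_rsub[OF Form_bilinear]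
  bilinear_lzero[OF Form_bilinear] bilinear_rzero[OF Form_bilinear]

lemma Form_sym: "II u v = II v u"
  using marked by (simp add: marked_elliptic_root_system_def)

lemma subspace_F: "subspace (Fsp E)"
  using marked by (simp add: marked_elliptic_root_system_def)

lemma radI_subset_F: "radI E \<subseteq> Fsp E"
  by (auto simp: form_rad_def)

lemma subspace_radI: "subspace (radI E)"
  using subspace_F unfolding subspace_def form_rad_def by (auto simp: Form_simps)

lemma a_in_radI: "aa \<in> radI E"
proof -
  have m: "Mark E \<inter> root_lattice (Roots E) = {of_int k *\<^sub>R aa | k :: int. True}" "Mark E \<subseteq> radI E"
    using marked unfolding marked_elliptic_root_system_def marking_def by simp_all
  have "aa \<in> {of_int k *\<^sub>R aa | k :: int. True}" by (intro CollectI exI[of _ 1]) simp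
  then show ?thesis using m(2) unfolding m(1)[symmetric] by auto
qed

lemma d_in_radI: "\<delta> \<in> radI E"
proof -
  have m: "root_lattice (Roots E) \<inter> radI E = {of_int k *\<^sub>R aa + of_int m *\<^sub>R \<delta> | (k :: int) (m :: int). True}"
    using marked unfolding marked_elliptic_root_system_def marking_def by simp
  have "\<delta> \<in> {of_int k *\<^sub>R aa + of_int m *\<^sub>R \<delta> | (k :: int) (m :: int). True}"
    by (intro CollectI exI[of _ 0] exI[of _ 1]) simp
  then show ?thesis unfolding m[symmetric] by simp
qed

lemma Form_a [simp]: "II u aa = 0"
proof -
  have "aa \<in> form_rad II UNIV"
    using marked by (simp add: marked_elliptic_root_system_def hyperbolic_extension_def span_base)
  then show ?thesis by (simp add: form_rad_def Form_sym[of u])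
qed

lemma Form_F_radI: "u \<in> Fsp E \<Longrightarrow> r \<in> radI E \<Longrightarrow> II u r = 0"
  using Form_sym[of u r] by (auto simp: form_rad_def)

lemma Form_F_d: "u \<in> Fsp E \<Longrightarrow> II u \<delta> = 0"
  using Form_F_radI d_in_radI by blast

lemma Form_Lam0_d: "II (Lam0 E) \<delta> = 1"
  using marked by (simp add: marked_elliptic_root_system_def hyperbolic_extension_def)

lemma linear_Form_d: "linear (\<lambda>u. II u \<delta>)"
  using Form_bilinear by (simp add: bilinear_def)

text \<open>F lies in the kernel of I(-, \<delta>), which is a proper subspace because it misses
  \<Lambda>_0; as F is a hyperplane, the two agree.\<close>

lemma F_iff: "u \<in> Fsp E \<longleftrightarrow> II u \<delta> = 0"
proof -
  let ?K = "{u. II u \<delta> = 0}"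
  have K: "subspace ?K"
    by (rule linear_subspace_kernel[OF linear_Form_d])
  have "Lam0 E \<notin> ?K" using Form_Lam0_d by simp
  then have "?K \<noteq> UNIV" by blast
  then have "dim ?K \<noteq> DIM('v)" using K dim_eq_full[of ?K] by (simp add: span_eq_iff[THEN iffD2])
  then have "dim ?K \<le> dim (Fsp E)"
    using dim_subset_UNIV[of ?K] marked by (simp add: marked_elliptic_root_system_def)
  then have "Fsp E = ?K"
    using Form_F_d by (intro subspace_dim_equal subspace_F K) auto
  then show ?thesis by auto
qed

text \<open>The vector a is orthogonal to everything while I(\<Lambda>_0, \<delta>) = 1, so a and
  \<delta> are independent and span the two-dimensional radical over the reals.\<close>

lemma radI_eq: "r \<in> radI E \<longleftrightarrow> (\<exists>\<alpha> \<beta>. r = \<alpha> *\<^sub>R aa + \<beta> *\<^sub>R \<delta>)"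
proof -
  have a0: "aa \<noteq> 0" using marked by (simp add: marked_elliptic_root_system_def marking_def)
  have "\<delta> \<notin> span {aa}"
  proof
    assume "\<delta> \<in> span {aa}"
    then have "II (Lam0 E) \<delta> = 0" by (auto simp: span_singleton Form_simps)
    then show False by (simp add: Form_Lam0_d)
  qed
  then have ind: "independent {\<delta>, aa}" and ne: "\<delta> \<noteq> aa"
    using a0 by (auto simp: independent_insert span_base)
  have "span {\<delta>, aa} = radI E"
  proof (rule subspace_dim_equal)
    show "span {\<delta>, aa} \<subseteq> radI E"
      by (rule span_minimal) (use a_in_radI d_in_radI subspace_radI in auto)
    show "dim (radI E) \<le> dim (span {\<delta>, aa})"
      using marked ne ind by (simp add: marked_elliptic_root_system_def dim_eq_card_independent)
  qed (auto intro: subspace_radI)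
  then have "r \<in> radI E \<longleftrightarrow> r \<in> span {\<delta>, aa}" by simp
  also have "\<dots> \<longleftrightarrow> (\<exists>\<beta> \<alpha>. r - \<beta> *\<^sub>R \<delta> = \<alpha> *\<^sub>R aa)"
    by (auto simp: span_insert span_singleton)
  also have "\<dots> \<longleftrightarrow> (\<exists>\<alpha> \<beta>. r = \<alpha> *\<^sub>R aa + \<beta> *\<^sub>R \<delta>)"
    unfolding diff_eq_eq by blast
  finally show ?thesis .
qed

text \<open>If I(u, v) were nonzero for some v in F, then v + t u would have norm -1 for the t
  chosen below, contradicting positive semi-definiteness on F.\<close>

lemma isotropic_in_radI:
  assumes u: "u \<in> Fsp E" and "II u u = 0"
  shows "u \<in> radI E"
  unfolding form_rad_def
proof (intro CollectI conjI ballI u)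
  fix v assume v: "v \<in> Fsp E"
  show "II u v = 0"
  proof (rule ccontr)
    assume n: "II u v \<noteq> 0"
    define t where "t = - (II v v + 1) / (2 * II u v)"
    have "v + t *\<^sub>R u \<in> Fsp E" using subspace_F u v by (simp add: subspace_def)
    then have "0 \<le> II (v + t *\<^sub>R u) (v + t *\<^sub>R u)"
      using marked by (simp add: marked_elliptic_root_system_def)
    also have "\<dots> = II v v + 2 * t * II u v"
      using assms(2) Form_sym[of v u] by (simp add: Form_simps)
    also have "\<dots> = - 1" using n by (simp add: t_def field_simps)
    finally show False by simp
  qed
qed

lemma vertical_radI: "e \<in> vertical E \<Longrightarrow> r \<in> radI E \<Longrightarrow> blinfun_apply e r = 0"
  by (auto simp: radI_eq vertical_def blinfun.add_right blinfun.scaleR_right)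

definition \<kappa> where "\<kappa> = even_scale E * real (dmax E) / mmax E"

text \<open>F and \<Lambda>_0 span the whole space through u - I(u, \<delta>) \<Lambda>_0 \<in> F,
  so the two conditions defining the Euler vector determine it.\<close>

lemma euler_vec_apply: "blinfun_apply (euler_vec E) u = of_real (\<kappa> * II u \<delta>)"
proof -
  define e where "e = Blinfun (\<lambda>u. complex_of_real (\<kappa> * II u \<delta>))"
  have "linear (\<lambda>u. complex_of_real (\<kappa> * II u \<delta>))"
    by (rule linearI) (auto simp: Form_simps algebra_simps scaleR_conv_of_real)
  then have e: "blinfun_apply e u = of_real (\<kappa> * II u \<delta>)" for u
    unfolding e_def by (simp add: bounded_linear_Blinfun_apply linear_conv_bounded_linear)
  have "euler_vec E = e"
    unfolding euler_vec_def
  proof (rule the_equality)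
    show "(\<forall>u\<in>Fsp E. blinfun_apply e u = 0) \<and> blinfun_apply e (Lam0 E) =
        of_real (even_scale E * real (dmax E) / mmax E)"
      by (simp add: e F_iff Form_Lam0_d \<kappa>_def)
    fix e' :: "'v \<Rightarrow>\<^sub>L complex"
    assume e': "(\<forall>u\<in>Fsp E. blinfun_apply e' u = 0) \<and> blinfun_apply e' (Lam0 E) =
        of_real (even_scale E * real (dmax E) / mmax E)"
    show "e' = e"
    proof (rule blinfun_eqI)
      fix u
      have "u - II u \<delta> *\<^sub>R Lam0 E \<in> Fsp E" by (simp add: F_iff Form_simps Form_Lam0_d)
      then have "blinfun_apply e' (u - II u \<delta> *\<^sub>R Lam0 E) = 0" using e' by blast
      then show "blinfun_apply e' u = blinfun_apply e u"
        using e' by (simp add: e blinfun.diff_right blinfun.scaleR_right \<kappa>_def scaleR_conv_of_real)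
    qed
  qed
  then show ?thesis by (simp add: e)
qed

lemma euler_vertical: "euler_vec E \<in> vertical E"
  using Form_F_d[OF subsetD[OF radI_subset_F a_in_radI]] Form_F_d[OF subsetD[OF radI_subset_F d_in_radI]]
  by (simp add: vertical_def euler_vec_apply)

text \<open>Along the line through y in the Euler direction the Euler equation reads f' = m f, so
  exp(- m s) f is constant.\<close>

lemma SWhom_translate:
  assumes f: "f \<in> SWhom E m" and y: "y \<in> YY E"
  shows "f (y + hscale s (euler_vec E)) = exp (of_nat m * s) * f y"
proof -
  let ?e = "euler_vec E"
  have D: "((\<lambda>t. f (y + hscale t ?e)) has_field_derivative of_nat m * f (y + hscale s ?e)) (at s)" for s
  proof -
    have "((\<lambda>t. f ((y + hscale s ?e) + hscale t ?e)) has_field_derivative of_nat m * f (y + hscale s ?e)) (at 0)"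
      using f YY_add_vertical[OF y euler_vertical, of s] unfolding SWhom_def by blast
    then have "((\<lambda>t. f (y + hscale (t + s) ?e)) has_field_derivative of_nat m * f (y + hscale s ?e)) (at 0)"
      by (simp add: add_ac)
    then show ?thesis
      using DERIV_shift[of "\<lambda>t. f (y + hscale t ?e)" _ 0 s] by simp
  qed
  have "((\<lambda>t. exp (- (of_nat m * t)) * f (y + hscale t ?e)) has_field_derivative 0) (at s)" for s
    by (rule derivative_eq_intros D refl | simp)+
  then obtain C where "exp (- (of_nat m * t)) * f (y + hscale t ?e) = C" for t
    using has_field_derivative_zero_constant[of UNIV "\<lambda>t. exp (- (of_nat m * t)) * f (y + hscale t ?e)"]
    by auto
  from this[of s] this[of 0] have "exp (- (of_nat m * s)) * f (y + hscale s ?e) = f y" by simp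
  then show ?thesis by (simp add: exp_minus field_simps)
qed

text \<open>The largest exponent is \<open>mmax E\<close>, so the last degree is
  \<open>dmax E\<close>. Positivity excludes \<open>mmax E = 0\<close>, where division by zero would
  make every degree 0.\<close>

lemma deg_le_dmax:
  assumes "\<And>i. i < nn E \<Longrightarrow> 0 < deg E i" "\<And>i j. i \<le> j \<Longrightarrow> j < nn E \<Longrightarrow> deg E i \<le> deg E j" "i < nn E"
  shows "deg E i \<le> dmax E"
proof -
  have "mmax E \<noteq> 0" using assms(1)[of 0] by (auto simp: deg_def)
  then have "deg E (rnk E) = dmax E" by (simp add: deg_def mmax_def[symmetric])
  then show ?thesis using assms(2)[of i "rnk E"] assms(3) by simp
qed

text \<open>If one of \<open>mmax E\<close>, \<open>dmax E\<close> or \<open>even_scale E\<close>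
  vanished, so would the first degree; a zero \<open>even_scale E\<close> makes all exponents 0 and
  hence \<open>mmax E = 0\<close>.\<close>

lemma \<kappa>_nonzero:
  assumes "0 < deg E 0"
  shows "\<kappa> \<noteq> 0"
proof -
  have m: "mmax E \<noteq> 0" using assms by (auto simp: deg_def)
  have d: "dmax E \<noteq> 0"
  proof
    assume "dmax E = 0"
    then show False using assms by (simp add: deg_def)
  qed
  have "even_scale E \<noteq> 0"
  proof
    assume "even_scale E = 0"
    then have "exponents E = sort (map (\<lambda>i. 0) [0..<nn E])" by (simp add: exponents_def)
    then have "set (exponents E) \<subseteq> {0}" "length (exponents E) = nn E" by auto
    then have "mmax E = 0" unfolding mmax_def by (metis less_add_one nth_mem singletonD subsetD)
    with m show False by simp
  qed
  with m d show ?thesis by (simp add: \<kappa>_def)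
qed

end

section \<open>Splittings of the radical\<close>

locale splitting = marked_elliptic E for E :: "'v::euclidean_space elliptic_data" +
  fixes L :: "'v set"
  assumes complement: "complement_of_radI E L"
begin

definition radproj :: "'v \<Rightarrow> 'v" where
  "radproj u = (THE r. r \<in> radI E \<and> u - r \<in> L)"

lemma subspace_L: "subspace L"
  using complement by (simp add: complement_of_radI_def)

lemma L_Int_radI: "u \<in> L \<Longrightarrow> u \<in> radI E \<Longrightarrow> u = 0"
  using complement by (auto simp: complement_of_radI_def)

lemma radproj_eqI:
  assumes "r \<in> radI E" "u - r \<in> L"
  shows "radproj u = r"
  unfolding radproj_def
proof (rule the_equality)
  fix s assume s: "s \<in> radI E \<and> u - s \<in> L"
  then have "s - r \<in> radI E" "(u - r) - (u - s) \<in> L"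
    using assms subspace_diff[OF subspace_radI] subspace_diff[OF subspace_L] by blast+
  then show "s = r" using L_Int_radI[of "s - r"] by simp
qed (use assms in blast)

lemma radproj_in: "radproj u \<in> radI E" and radproj_diff_in: "u - radproj u \<in> L"
proof -
  obtain v r where "v \<in> L" "r \<in> radI E" "u = v + r"
    using complement unfolding complement_of_radI_def by blast
  with radproj_eqI[of r u] show "radproj u \<in> radI E" "u - radproj u \<in> L" by auto
qed

lemma radproj_radI [simp]: "r \<in> radI E \<Longrightarrow> radproj r = r"
  by (rule radproj_eqI) (auto simp: subspace_0[OF subspace_L])

lemma radproj_L [simp]: "v \<in> L \<Longrightarrow> radproj v = 0"
  by (rule radproj_eqI) (auto simp: subspace_0[OF subspace_radI])

lemma linear_radproj: "linear radproj"
proof (rule linearI)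
  fix u v :: 'v and c :: real
  have "(u - radproj u) + (v - radproj v) \<in> L"
    by (intro subspace_add[OF subspace_L] radproj_diff_in)
  then show "radproj (u + v) = radproj u + radproj v"
    by (intro radproj_eqI subspace_add[OF subspace_radI] radproj_in) (simp add: algebra_simps)
  have "c *\<^sub>R (u - radproj u) \<in> L"
    by (intro subspace_scale[OF subspace_L] radproj_diff_in)
  then show "radproj (c *\<^sub>R u) = c *\<^sub>R radproj u"
    by (intro radproj_eqI subspace_scale[OF subspace_radI] radproj_in) (simp add: algebra_simps)
qed

text \<open>The point of \<open>perpY E L\<close> over the same point of H as y (see
  \<open>sec_prH\<close>): composing with the projection kills L and keeps the values on the
  radical.\<close>

definition base :: "('v \<Rightarrow>\<^sub>L complex) \<Rightarrow> ('v \<Rightarrow>\<^sub>L complex)" where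
  "base y = y o\<^sub>L Blinfun radproj"

lemma base_apply [simp]: "blinfun_apply (base y) u = blinfun_apply y (radproj u)"
  using linear_radproj by (simp add: base_def bounded_linear_Blinfun_apply linear_conv_bounded_linear)

lemma base_eqI:
  assumes "\<And>r. r \<in> radI E \<Longrightarrow> blinfun_apply x r = blinfun_apply y r"
  shows "base x = base y"
  by (rule blinfun_eqI) (simp add: assms radproj_in)

lemma base_in_YY: "y \<in> YY E \<Longrightarrow> base y \<in> YY E"
  using a_in_radI d_in_radI by (simp add: YY_def)

lemma sec_prH:
  assumes y: "y \<in> YY E"
  shows "sec E L (prH E y) = base y"
  unfolding sec_def
proof (rule the_equality)
  show "base y \<in> perpY E L \<and> prH E (base y) = prH E y"
    using base_in_YY[OF y] by (auto simp: perpY_def prH_def blinfun.zero_right intro!: restrict_ext)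
  fix p assume p: "p \<in> perpY E L \<and> prH E p = prH E y"
  have rad: "blinfun_apply p r = blinfun_apply y r" if "r \<in> radI E" for r
    using p that unfolding prH_def by (metis restrict_apply')
  show "p = base y"
  proof (rule blinfun_eqI)
    fix u
    have "blinfun_apply p (u - radproj u) = 0"
      using p radproj_diff_in by (auto simp: perpY_def)
    then show "blinfun_apply p u = blinfun_apply (base y) u"
      by (simp add: blinfun.diff_right rad radproj_in)
  qed
qed

lemma hol_curve_base:
  assumes "hol_curve E \<gamma>"
  shows "hol_curve E (\<lambda>t. base (\<gamma> t))"
  unfolding hol_curve_def
proof (intro allI conjI)
  fix t
  show "base (\<gamma> t) \<in> YY E" using assms base_in_YY by (auto simp: hol_curve_def)
  obtain v where v: "blinfun_apply v aa = 0" "(\<gamma> has_derivative (\<lambda>h. hscale h v)) (at t)"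
    using assms unfolding hol_curve_def by blast
  have "bounded_linear base"
    unfolding base_def by (rule bounded_bilinear.bounded_linear_left[OF bounded_bilinear_blinfun_compose])
  from bounded_linear.has_derivative[OF this v(2)]
  have "((\<lambda>t. base (\<gamma> t)) has_derivative (\<lambda>h. base (hscale h v))) (at t)" .
  moreover have "base (hscale h v) = hscale h (base v)" for h by (rule blinfun_eqI) simp
  ultimately show "\<exists>v. blinfun_apply v aa = 0 \<and> ((\<lambda>t. base (\<gamma> t)) has_derivative (\<lambda>h. hscale h v)) (at t)"
    using v(1) a_in_radI by (intro exI[of _ "base v"]) auto
qed

lemma curve_hol_base:
  assumes f: "curve_hol E f"
  shows "curve_hol E (\<lambda>y. f (base y))"
  unfolding curve_hol_def
proof (intro conjI allI impI)
  have "bounded_linear base"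
    unfolding base_def by (rule bounded_bilinear.bounded_linear_left[OF bounded_bilinear_blinfun_compose])
  then have cont: "continuous_on (YY E) base" by (rule linear_continuous_on)
  show "continuous_on (YY E) (\<lambda>y. f (base y))"
    by (rule continuous_on_compose2[OF _ cont])
      (use f base_in_YY in \<open>auto simp: curve_hol_def\<close>)
  show "(\<lambda>t. f (base (\<gamma> t))) holomorphic_on UNIV" if "hol_curve E \<gamma>" for \<gamma>
    by (rule curve_holD[OF f hol_curve_base[OF that]])
qed

text \<open>As g preserves L and fixes the radical, it does not change the projection to the
  radical; hence it fixes every \<open>base y\<close>.\<close>

lemma act_fun_base:
  assumes g: "g \<in> Otilde E" "g ` L = L"
  shows "act_fun g f (base y) = f (base y)"
proof -
  have bij: "bij g" and lin: "linear g" and rfix: "\<And>r. r \<in> radI E \<Longrightarrow> g r = r"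
    using g by (auto simp: Otilde_def)
  have "radproj (g u) = radproj u" for u
  proof (rule radproj_eqI)
    have "g (u - radproj u) \<in> L" using g(2) radproj_diff_in[of u] by blast
    then show "g u - radproj u \<in> L" by (simp add: linear_diff[OF lin] rfix radproj_in)
  qed (rule radproj_in)
  then have eq: "(\<lambda>u. blinfun_apply (base y) (g u)) = blinfun_apply (base y)" by (simp add: fun_eq_iff)
  show ?thesis
    unfolding act_fun_def act_pt_def inv_inv_eq[OF bij] eq blinfun_apply_inverse ..
qed

text \<open>At a point fixed by g, an eigenfunction with eigenvalue other than 1 equals a proper
  multiple of itself. This serves for the invariants of degree below \<open>dmax E\<close>.\<close>

lemma SWhom_base_eq_0:
  assumes g: "g \<in> Otilde E" "g ` L = L" and "act_fun g f = fscale \<mu> f" "\<mu> \<noteq> 1"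
  shows "f (base y) = 0"
proof -
  have "f (base y) = \<mu> * f (base y)"
    using act_fun_base[OF g, of f y] assms(3) by (simp add: fscale_def)
  with \<open>\<mu> \<noteq> 1\<close> show ?thesis by simp
qed

lemma blinfun_eq_on_basis:
  assumes z: "cvec_basis n z (L \<times> L)"
    and rad: "\<And>r. r \<in> radI E \<Longrightarrow> blinfun_apply x r = blinfun_apply y r"
    and zz: "\<And>i. i < n \<Longrightarrow> cpair (z i) x = cpair (z i) y"
  shows "x = y"
proof (rule blinfun_eqI)
  fix u
  let ?l = "u - radproj u"
  have "(?l, 0) \<in> L \<times> L" using radproj_diff_in subspace_0[OF subspace_L] by simp
  then obtain c where c: "(?l, 0) = (\<Sum>i<n. cscale (c i) (z i))"
    using cvec_basis_expand[OF z] by blast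
  have "cpair (?l, 0) x = cpair (?l, 0) y"
    unfolding c by (simp add: cpair_sum zz del: sum.lessThan_Suc)
  then have "blinfun_apply x ?l = blinfun_apply y ?l" by (simp add: cpair_def blinfun.zero_right)
  then show "blinfun_apply x u = blinfun_apply y u"
    by (simp add: blinfun.diff_right rad radproj_in)
qed

text \<open>The definite description in \<open>coord_vec\<close> is met by the i-th coefficient
  functional on the complexification of L, extended by 0 to the radical;
  \<open>blinfun_eq_on_basis\<close> gives uniqueness.\<close>

lemma coord_vec_vertical_dual:
  assumes z: "cvec_basis (nn E) z (L \<times> L)" and i: "i < nn E"
  shows "coord_vec E z i \<in> vertical E"
    and "j < nn E \<Longrightarrow> cpair (z j) (coord_vec E z i) = (if j = i then 1 else 0)"
proof -
  define B where "B = z ` {..<nn E}"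
  have B: "\<not> cvec.dependent B" "cvec.span B = L \<times> L" and inj: "inj_on z {..<nn E}"
    using z by (auto simp: cvec_basis_def B_def)
  define \<phi> where "\<phi> w = cvec.representation B w (z i)" for w
  have add: "\<phi> (v + w) = \<phi> v + \<phi> w" if "v \<in> L \<times> L" "w \<in> L \<times> L" for v w
    using that B by (simp add: \<phi>_def cvec.representation_add)
  have scale: "\<phi> (cscale c w) = c * \<phi> w" if "w \<in> L \<times> L" for c w
    using that B by (simp add: \<phi>_def cvec.representation_scale)
  define e where "e = Blinfun (\<lambda>u. \<phi> (u - radproj u, 0))"
  have L0: "(u - radproj u, 0) \<in> L \<times> L" for u
    using radproj_diff_in subspace_0[OF subspace_L] by simp
  have "linear (\<lambda>u. \<phi> (u - radproj u, 0))"
  proof (rule linearI)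
    fix u v :: 'v and c :: real
    have "(u + v - radproj (u + v), 0) = (u - radproj u, 0) + (v - radproj v, 0 :: 'v)"
      by (simp add: linear_add[OF linear_radproj])
    then show "\<phi> (u + v - radproj (u + v), 0) = \<phi> (u - radproj u, 0) + \<phi> (v - radproj v, 0)"
      using add[OF L0 L0] by metis
    have "(c *\<^sub>R u - radproj (c *\<^sub>R u), 0) = cscale (of_real c) (u - radproj u, 0 :: 'v)"
      by (simp add: linear_scale[OF linear_radproj] cscale_def algebra_simps)
    then show "\<phi> (c *\<^sub>R u - radproj (c *\<^sub>R u), 0) = c *\<^sub>R \<phi> (u - radproj u, 0)"
      using scale[OF L0] by (metis scaleR_conv_of_real)
  qed
  then have e: "blinfun_apply e u = \<phi> (u - radproj u, 0)" for u
    unfolding e_def by (simp add: bounded_linear_Blinfun_apply linear_conv_bounded_linear)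
  have \<phi>0: "\<phi> 0 = 0" by (simp add: \<phi>_def cvec.representation_zero)
  have rad: "blinfun_apply e r = 0" if "r \<in> radI E" for r
    using that \<phi>0 by (simp add: e zero_prod_def)
  \<comment> \<open>The functional e is built from real vectors only; writing w = (u, 0) + i (v, 0)
    recovers \<phi> on the whole complexification.\<close>
  have pair: "cpair w e = \<phi> w" if wL: "w \<in> L \<times> L" for w
  proof -
    obtain u v where w: "w = (u, v)" "u \<in> L" "v \<in> L" using wL by auto
    have L0: "(u, 0) \<in> L \<times> L" "(v, 0) \<in> L \<times> L" "cscale \<i> (v, 0) \<in> L \<times> L"
      using w subspace_0[OF subspace_L] by (auto simp: cscale_def)
    have "w = (u, 0) + cscale \<i> (v, 0)" by (simp add: w cscale_def)
    then have "\<phi> w = \<phi> (u, 0) + \<i> * \<phi> (v, 0)" using add[OF L0(1,3)] scale[OF L0(2)] by metis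
    then show ?thesis using w by (simp add: cpair_def e)
  qed
  have dual: "cpair (z j) e = (if j = i then 1 else 0)" if j: "j < nn E" for j
  proof -
    have "z j \<in> B" using j by (simp add: B_def)
    then have "\<phi> (z j) = (if z j = z i then 1 else 0)"
      using B by (simp add: \<phi>_def cvec.representation_basis)
    also have "z j = z i \<longleftrightarrow> j = i" using inj i j by (auto dest: inj_onD)
    finally show ?thesis using pair[OF cvec_basis_mem[OF z j]] by simp
  qed
  have "coord_vec E z i = e"
    unfolding coord_vec_def
  proof (rule the_equality)
    show "blinfun_apply e aa = 0 \<and> blinfun_apply e \<delta> = 0 \<and>
        (\<forall>j<nn E. cpair (z j) e = (if j = i then 1 else 0))"
      using rad a_in_radI d_in_radI dual by blast
    fix e' assume e': "blinfun_apply e' aa = 0 \<and> blinfun_apply e' \<delta> = 0 \<and>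
        (\<forall>j<nn E. cpair (z j) e' = (if j = i then 1 else 0))"
    then have "e' \<in> vertical E" by (simp add: vertical_def)
    then show "e' = e"
      using e' dual by (intro blinfun_eq_on_basis[OF z]) (auto simp: vertical_radI rad)
  qed
  moreover have "e \<in> vertical E" using rad a_in_radI d_in_radI by (simp add: vertical_def)
  ultimately show "coord_vec E z i \<in> vertical E"
    and "j < nn E \<Longrightarrow> cpair (z j) (coord_vec E z i) = (if j = i then 1 else 0)"
    using dual by auto
qed

text \<open>The orbit of y under the weighted dilation of its fibre, the i-th coordinate being
  multiplied by t^\<open>deg E i\<close>. For positive degrees it starts at \<open>base y\<close>
  for t = 0.\<close>

definition weight_curve :: "(nat \<Rightarrow> 'v \<times> 'v) \<Rightarrow> ('v \<Rightarrow>\<^sub>L complex) \<Rightarrow> complex \<Rightarrow> ('v \<Rightarrow>\<^sub>L complex)" where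
  "weight_curve z y t = base y + (\<Sum>i<nn E. hscale (t ^ deg E i * cpair (z i) y) (coord_vec E z i))"

lemma weight_curve_radI:
  assumes z: "cvec_basis (nn E) z (L \<times> L)" and r: "r \<in> radI E"
  shows "blinfun_apply (weight_curve z y t) r = blinfun_apply y r"
proof -
  have "blinfun_apply (\<Sum>i<n. hscale (t ^ deg E i * cpair (z i) y) (coord_vec E z i)) r = 0" if "n \<le> nn E" for n
    using that
  proof (induction n)
    case (Suc n)
    then show ?case using vertical_radI[OF coord_vec_vertical_dual(1)[OF z, of n] r]
      by (simp add: blinfun.add_left)
  qed simp
  then show ?thesis using r by (simp add: weight_curve_def blinfun.add_left del: sum.lessThan_Suc)
qed

lemma cpair_base: "w \<in> L \<times> L \<Longrightarrow> cpair w (base y) = 0"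
  by (auto simp: cpair_def blinfun.zero_right)

text \<open>An eigenvector for \<zeta>^d is a combination of those basis vectors z_i whose degree is
  d, because degrees between 1 and \<open>dmax E\<close> are determined by their powers of \<zeta>.
  So the curve depends on the eigenspaces in L and not on the basis z.\<close>

lemma cpair_weight_curve:
  assumes z: "homogeneous_basis E g \<zeta> L z" and g: "linear g" and \<zeta>: "primitive_root (dmax E) \<zeta>"
    and deg: "\<And>i. i < nn E \<Longrightarrow> 0 < deg E i \<and> deg E i \<le> dmax E"
    and w: "w \<in> L \<times> L" "map_prod g g w = cscale (\<zeta> ^ d) w" and d: "0 < d" "d \<le> dmax E"
  shows "cpair w (weight_curve z y t) = t ^ d * cpair w y"
proof -
  have zb: "cvec_basis (nn E) z (L \<times> L)" using z by (simp add: homogeneous_basis_def)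
  obtain c where c: "w = (\<Sum>i<nn E. cscale (c i) (z i))" using cvec_basis_expand[OF zb w(1)] .
  have dual: "cpair (z j) (weight_curve z y t) = t ^ deg E j * cpair (z j) y" if j: "j < nn E" for j
  proof -
    have "cpair (z j) (weight_curve z y t)
        = (\<Sum>i<nn E. t ^ deg E i * cpair (z i) y * cpair (z j) (coord_vec E z i))"
      using cvec_basis_mem[OF zb j] by (simp add: weight_curve_def cpair_sum cpair_base del: sum.lessThan_Suc)
    also have "\<dots> = (\<Sum>i<nn E. if i = j then t ^ deg E i * cpair (z i) y else 0)"
      using coord_vec_vertical_dual(2)[OF zb _ j] by (intro sum.cong) auto
    also have "\<dots> = t ^ deg E j * cpair (z j) y" using j by (simp del: sum.lessThan_Suc)
    finally show ?thesis .
  qed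
  have "c i * (t ^ deg E i * cpair (z i) y) = t ^ d * (c i * cpair (z i) y)" if i: "i < nn E" for i
    using homogeneous_basis_eigenvector_coeff[OF z g c w(2) i] primitive_root_power_inj[OF \<zeta>, of "deg E i" d] deg[OF i] d
    by (auto simp: mult_ac)
  then have "(\<Sum>i<nn E. c i * (t ^ deg E i * cpair (z i) y)) = (\<Sum>i<nn E. t ^ d * (c i * cpair (z i) y))"
    by (intro sum.cong[OF refl]) simp
  then show ?thesis
    unfolding c by (simp add: cpair_sum dual sum_distrib_left del: sum.lessThan_Suc)
qed

lemma weight_curve_in_YY:
  assumes z: "cvec_basis (nn E) z (L \<times> L)" and y: "y \<in> YY E"
  shows "weight_curve z y t \<in> YY E"
  using weight_curve_radI[OF z] a_in_radI d_in_radI y by (simp add: YY_def)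

lemma hol_curve_weight_curve:
  assumes z: "cvec_basis (nn E) z (L \<times> L)" and y: "y \<in> YY E"
  shows "hol_curve E (weight_curve z y)"
proof -
  have "hol_curve E (\<lambda>t. base y + (\<Sum>i<n. hscale (t ^ deg E i * cpair (z i) y) (coord_vec E z i)))"
    if "n \<le> nn E" for n
    using that
  proof (induction n)
    case 0
    show ?case using hol_curve_const[OF base_in_YY[OF y]] by simp
  next
    case (Suc n)
    then have "hol_curve E (\<lambda>t. (base y + (\<Sum>i<n. hscale (t ^ deg E i * cpair (z i) y) (coord_vec E z i)))
        + hscale (t ^ deg E n * cpair (z n) y) (coord_vec E z n))"
      by (intro hol_curve_add coord_vec_vertical_dual(1)[OF z]) (auto intro!: holomorphic_intros)
    then show ?case by (simp add: add.assoc)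
  qed
  then show ?thesis unfolding weight_curve_def[abs_def] by blast
qed

text \<open>An isotropic member k of the orthogonal basis is orthogonal to all of L. It is not in F,
  since isotropic vectors of F lie in the radical, which meets L in 0. For the same reason g k - k
  vanishes: it lies in L and F, and it is isotropic because g k is again orthogonal to L. Dividing
  by I(k, \<delta>) normalizes k.\<close>

lemma zero_type_vector:
  assumes zt: "zero_type E L" and g: "g \<in> Otilde E" "g ` L = L" "\<And>u. g u - u \<in> Fsp E"
  obtains u where "u \<in> L" "II u \<delta> = 1" "II u u = 0" "g u = u"
proof -
  have lin: "linear g" and inv: "\<And>u v. II (g u) (g v) = II u v"
    using g(1) by (auto simp: Otilde_def)
  obtain b where b: "finite b" "independent b" "span b = L"
    "\<forall>u\<in>b. \<forall>v\<in>b. u \<noteq> v \<longrightarrow> II u v = 0" "card {u \<in> b. II u u = 0} = 1"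
    using zt unfolding zero_type_def has_signature_def by blast
  from b(5) have "{u \<in> b. II u u = 0} \<noteq> {}" by (metis card.empty zero_neq_one)
  then obtain k where k: "k \<in> b" "II k k = 0" by blast
  have kL: "k \<in> L" using b(3) k span_base by blast
  have orth: "II k v = 0" if "v \<in> L" for v
  proof -
    have "v \<in> span b" using that b(3) by simp
    then show ?thesis
    proof (induction rule: span_induct_alt)
      case (step c x y)
      then have "II k x = 0" using b(4) k by (cases "k = x") auto
      then show ?case using step by (simp add: Form_simps)
    qed (simp add: Form_simps)
  qed
  have zero: "u = 0" if "u \<in> L" "u \<in> Fsp E" "II u u = 0" for u
    using L_Int_radI[OF that(1) isotropic_in_radI[OF that(2,3)]] .
  have "k \<noteq> 0" using b(2) k dependent_zero by blast
  then have kd: "II k \<delta> \<noteq> 0" using zero[OF kL] orth[OF kL] F_iff by blast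
  have orth_g: "II (g k) v = 0" if v: "v \<in> L" for v
  proof -
    have "v \<in> g ` L" using v g(2) by simp
    then obtain w where "w \<in> L" "v = g w" by blast
    then show ?thesis using inv orth by simp
  qed
  have gk: "g k \<in> L" using g(2) kL by blast
  then have "g k - k \<in> L" using kL subspace_diff[OF subspace_L] by blast
  moreover have "II (g k - k) (g k - k) = 0"
    by (simp add: Form_simps orth[OF gk] orth[OF kL] orth_g[OF gk] orth_g[OF kL])
  ultimately have "g k - k = 0" using zero g(3) by blast
  then have "g k = k" by simp
  show ?thesis
  proof (rule that[of "(1 / II k \<delta>) *\<^sub>R k"])
    show "(1 / II k \<delta>) *\<^sub>R k \<in> L" by (intro subspace_scale[OF subspace_L] kL)
  qed (use kd k \<open>g k = k\<close> in \<open>simp_all add: Form_simps linear_scale[OF lin]\<close>)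
qed

end

section \<open>The map \<open>\<psi>\<close> by Taylor coefficients\<close>

lemma curve_hol_cong:
  assumes "curve_hol E f" "\<And>y. y \<in> YY E \<Longrightarrow> f y = g y"
  shows "curve_hol E g"
proof -
  have "(\<lambda>t. f (\<gamma> t)) = (\<lambda>t. g (\<gamma> t))" if "hol_curve E \<gamma>" for \<gamma>
    using that assms(2) by (auto simp: hol_curve_def)
  moreover have "continuous_on (YY E) g"
    using assms by (auto simp: curve_hol_def cong: continuous_on_cong)
  ultimately show ?thesis using assms(1) unfolding curve_hol_def by metis
qed

text \<open>Two scalars are allowed because the lemma serves both for differences of coefficients
  and for comparing an expansion with its Euler translate.\<close>

lemma FH_scale_diff:
  assumes "h \<in> FH E" "k \<in> FH E"
  shows "(\<lambda>t. c * h t - d * k t) \<in> FH E"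
proof -
  obtain \<phi> \<psi> where "\<phi> holomorphic_on {s. 0 < Re s}" "\<forall>t\<in>HH E. h t = \<phi> (t (dvec E))"
    "\<psi> holomorphic_on {s. 0 < Re s}" "\<forall>t\<in>HH E. k t = \<psi> (t (dvec E))"
    using assms by (auto simp: FH_def)
  moreover from this have "(\<lambda>s. c * \<phi> s - d * \<psi> s) holomorphic_on {s. 0 < Re s}"
    by (intro holomorphic_intros)
  ultimately show ?thesis
    using assms unfolding FH_def by (auto intro!: exI[of _ "\<lambda>s. c * \<phi> s - d * \<psi> s"])
qed

lemma FH_zero: "(\<lambda>_. 0) \<in> FH E"
  unfolding FH_def by (auto intro!: exI[of _ "\<lambda>_. 0"])

text \<open>Algebraic independence: after extension by 0 to the union of the index sets, both
  expansions have the same coefficients, so they also agree on any other family P. This makes the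
  F(H)-linear extension in \<open>psi\<close> well defined.\<close>

lemma FH_comb_unique:
  assumes x: "basic_invariants E x"
    and A: "finite A" "A \<subseteq> multi_index (nn E)" "\<forall>b\<in>A. h b \<in> FH E"
    and B: "finite B" "B \<subseteq> multi_index (nn E)" "\<forall>b\<in>B. k b \<in> FH E"
    and eq: "FH_comb E A h (monomial E x) = FH_comb E B k (monomial E x)"
  shows "FH_comb E A h P = FH_comb E B k P"
proof -
  define h' where "h' b = (if b \<in> A then h b else (\<lambda>_. 0))" for b
  define k' where "k' b = (if b \<in> B then k b else (\<lambda>_. 0))" for b
  define c where "c b = (\<lambda>t. 1 * h' b t - 1 * k' b t)" for b
  have split: "FH_comb E (A \<union> B) c Q y = FH_comb E A h Q y - FH_comb E B k Q y" for Q y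
  proof (cases "y \<in> YY E")
    case True
    have "(\<Sum>b\<in>A \<union> B. h' b (prH E y) * Q b y) = (\<Sum>b\<in>A. h b (prH E y) * Q b y)"
      using A B by (intro sum.mono_neutral_cong_right) (auto simp: h'_def)
    moreover have "(\<Sum>b\<in>A \<union> B. k' b (prH E y) * Q b y) = (\<Sum>b\<in>B. k b (prH E y) * Q b y)"
      using A B by (intro sum.mono_neutral_cong_right) (auto simp: k'_def)
    ultimately show ?thesis
      using True by (simp add: FH_comb_def c_def left_diff_distrib sum_subtractf)
  qed (simp add: FH_comb_def)
  have "FH_comb E (A \<union> B) c (monomial E x) = (\<lambda>_. 0)"
    by (simp add: fun_eq_iff split eq)
  moreover have "c b \<in> FH E" for b
    unfolding c_def using A B by (intro FH_scale_diff) (auto simp: h'_def k'_def FH_zero)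
  ultimately have "\<forall>b\<in>A \<union> B. c b = (\<lambda>_. 0)"
    using x A B unfolding basic_invariants_def by (metis (no_types, lifting) finite_UnI le_sup_iff)
  then have "FH_comb E (A \<union> B) c P y = 0" for y by (simp add: FH_comb_def)
  then show ?thesis using split[of P] by (simp add: fun_eq_iff)
qed

lemma psi_eqI:
  assumes x: "basic_invariants E x"
    and A: "finite A" "A \<subseteq> multi_index (nn E)" "\<forall>b\<in>A. h b \<in> FH E"
    and f: "f = FH_comb E A h (monomial E x)"
  shows "psi E L z x f = FH_comb E A h (psi_monomial E L z x)"
  unfolding psi_def
proof (rule the_equality)
  fix p assume "\<exists>A h. finite A \<and> A \<subseteq> multi_index (nn E) \<and> (\<forall>b\<in>A. h b \<in> FH E) \<and>
     f = FH_comb E A h (monomial E x) \<and> p = FH_comb E A h (psi_monomial E L z x)"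
  then obtain B k where B: "finite B" "B \<subseteq> multi_index (nn E)" "\<forall>b\<in>B. k b \<in> FH E"
    "f = FH_comb E B k (monomial E x)" "p = FH_comb E B k (psi_monomial E L z x)"
    by blast
  show "p = FH_comb E A h (psi_monomial E L z x)"
    unfolding B(5) by (rule FH_comb_unique[OF x B(1-3) A]) (use B(4) f in simp)
qed (use A f in blast)

lemma basic_invariants_SWhom: "basic_invariants E x \<Longrightarrow> i < nn E \<Longrightarrow> x i \<in> SWhom E (deg E i)"
  by (simp add: basic_invariants_def)

context marked_elliptic
begin

lemma prH_translate: "prH E (y + hscale s (euler_vec E)) = prH E y"
  using euler_vertical vertical_radI by (auto simp: prH_def blinfun.add_left intro!: restrict_ext)

lemma monomial_translate:
  assumes x: "basic_invariants E x" and y: "y \<in> YY E"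
  shows "monomial E x b (y + hscale s (euler_vec E)) = exp (of_nat (wdeg E b) * s) * monomial E x b y"
proof -
  have "monomial E x b (y + hscale s (euler_vec E)) = (\<Prod>i<nn E. (exp (of_nat (deg E i) * s) * x i y) ^ b i)"
    unfolding monomial_def
    by (intro prod.cong refl) (simp add: SWhom_translate[OF basic_invariants_SWhom[OF x] y])
  also have "\<dots> = (\<Prod>i<nn E. exp (of_nat (deg E i * b i) * s)) * monomial E x b y"
    unfolding monomial_def prod.distrib[symmetric]
    by (intro prod.cong refl) (simp add: power_mult_distrib exp_of_nat_mult[symmetric] mult_ac)
  also have "(\<Prod>i<nn E. exp (of_nat (deg E i * b i) * s)) = exp (of_nat (wdeg E b) * s)"
    by (simp add: wdeg_def exp_sum[symmetric] sum_distrib_right del: sum.lessThan_Suc prod.lessThan_Suc)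
  finally show ?thesis .
qed

text \<open>Translating by the Euler vector multiplies f by exp(m) and each monomial by the
  exponential of its weight. Uniqueness of expansions then kills every coefficient of weight other
  than m.\<close>

lemma homogeneous_representation:
  assumes x: "basic_invariants E x" and f: "f \<in> SWhom E m" "f \<in> SW E"
  obtains A h where "finite A" "A \<subseteq> multi_index (nn E)" "\<forall>b\<in>A. h b \<in> FH E" "\<forall>b\<in>A. wdeg E b = m"
    "f = FH_comb E A h (monomial E x)"
proof -
  obtain A h where A: "finite A" "A \<subseteq> multi_index (nn E)" "\<forall>b\<in>A. h b \<in> FH E"
    and fA: "f = FH_comb E A h (monomial E x)"
    using f(2) x unfolding basic_invariants_def by auto
  \<comment> \<open>The coefficients of f(y + e) - exp(m) f(y), with e the Euler vector; this
    function is 0 on the domain.\<close>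
  define h' where "h' b = (\<lambda>t. exp (of_nat (wdeg E b)) * h b t - exp (of_nat m) * h b t)" for b
  have "FH_comb E A h' (monomial E x) y = 0" for y
  proof (cases "y \<in> YY E")
    case True
    have Y: "y + hscale 1 (euler_vec E) \<in> YY E" using YY_add_vertical[OF True euler_vertical] .
    have "(\<Sum>b\<in>A. h b (prH E y) * (exp (of_nat (wdeg E b)) * monomial E x b y))
        = (\<Sum>b\<in>A. h b (prH E (y + hscale 1 (euler_vec E))) * monomial E x b (y + hscale 1 (euler_vec E)))"
      unfolding monomial_translate[OF x True] prH_translate by simp
    also have "\<dots> = f (y + hscale 1 (euler_vec E))"
      using Y by (simp only: fA FH_comb_def if_True)
    also have "\<dots> = exp (of_nat m) * f y" using SWhom_translate[OF f(1) True, of 1] by simp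
    also have "f y = (\<Sum>b\<in>A. h b (prH E y) * monomial E x b y)"
      using True by (simp only: fA FH_comb_def if_True)
    finally show ?thesis
      using True by (simp add: FH_comb_def h'_def left_diff_distrib right_diff_distrib sum_subtractf
          sum_distrib_left mult_ac)
  qed (simp add: FH_comb_def)
  then have "FH_comb E A h' (monomial E x) = (\<lambda>_. 0)" by (simp add: fun_eq_iff)
  moreover have "\<forall>b\<in>A. h' b \<in> FH E"
    unfolding h'_def using A by (auto intro!: FH_scale_diff)
  ultimately have h'0: "\<forall>b\<in>A. h' b = (\<lambda>_. 0)"
    using x A unfolding basic_invariants_def by blast
  have h0: "h b t = 0" if "b \<in> A" "wdeg E b \<noteq> m" for b t
  proof -
    have "h' b t = 0" using h'0 that by simp
    then have "(exp (of_nat (wdeg E b)) - exp (of_nat m)) * h b t = 0"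
      by (simp add: h'_def left_diff_distrib)
    \<comment> \<open>The complex exponential is not injective, but both exponents are real, so
      comparing norms suffices.\<close>
    moreover have "(exp (of_nat (wdeg E b)) :: complex) \<noteq> exp (of_nat m)"
    proof
      assume "(exp (of_nat (wdeg E b)) :: complex) = exp (of_nat m)"
      then have "norm (exp (of_nat (wdeg E b)) :: complex) = norm (exp (of_nat m) :: complex)" by simp
      with that show False by (simp add: norm_exp_eq_Re)
    qed
    ultimately show ?thesis by simp
  qed
  show ?thesis
  proof (rule that[of "{b \<in> A. wdeg E b = m}" h])
    have restrict: "(\<Sum>b\<in>A. h b (prH E y) * monomial E x b y) =
        (\<Sum>b\<in>{b \<in> A. wdeg E b = m}. h b (prH E y) * monomial E x b y)" for y
      using A h0 by (intro sum.mono_neutral_right) auto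
    show "f = FH_comb E {b \<in> A. wdeg E b = m} h (monomial E x)"
      unfolding fA FH_comb_def restrict ..
  qed (use A in auto)
qed

end

section \<open>\<open>psi\<close> as a Taylor coefficient, and the vectors of L fixed by g\<close>

context splitting
begin

lemma prH_weight_curve:
  assumes "cvec_basis (nn E) z (L \<times> L)"
  shows "prH E (weight_curve z y t) = prH E y"
  using weight_curve_radI[OF assms] by (auto simp: prH_def intro!: restrict_ext)

text \<open>The defining sum is that of \<open>taylor_coeff_multi\<close> at the point
  \<open>base y\<close> with s_i the i-th coordinate of y. The subtracted values are constant in t
  because the curve stays in one fibre over H.\<close>

lemma psi_monomial_eq_taylor_coeff:
  assumes x: "basic_invariants E x" and z: "cvec_basis (nn E) z (L \<times> L)" and y: "y \<in> YY E"
  shows "psi_monomial E L z x b y =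
    taylor_coeff (wdeg E b) (\<lambda>t. \<Prod>i<nn E. (x i (weight_curve z y t) - x i (base y)) ^ b i)"
proof -
  define F where "F = (\<lambda>y'. \<Prod>i<nn E. (x i y' - x i (sec E L (prH E y'))) ^ b i)"
  have xi: "curve_hol E (x i)" if "i < nn E" for i
    using basic_invariants_SWhom[OF x that] by (intro FY_curve_hol) (simp add: SWhom_def)
  have "curve_hol E (\<lambda>y'. \<Prod>i<nn E. (x i y' - x i (base y')) ^ b i)"
    by (intro curve_hol_prod_power curve_hol_diff curve_hol_base xi) simp_all
  then have F: "curve_hol E F"
    by (rule curve_hol_cong) (simp add: F_def sec_prH)
  have "psi_monomial E L z x b y = (\<Sum>b' | b' \<in> multi_index (nn E) \<and> (\<Sum>i<nn E. deg E i * b' i) = wdeg E b.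
       1 / of_nat (\<Prod>i<nn E. fact (b' i)) *
       foldr (\<lambda>i G. (dir_deriv (coord_vec E z i) ^^ b' i) \<circ> G) [0..<nn E] id F (base y) *
       (\<Prod>i<nn E. cpair (z i) y ^ b' i))"
    unfolding psi_monomial_def F_def[symmetric] sec_prH[OF y] multi_deriv_def wdeg_def ..
  also have "\<dots> = taylor_coeff (wdeg E b) (\<lambda>t. F (weight_curve z y t))"
    unfolding weight_curve_def
    by (rule taylor_coeff_multi[symmetric, OF F base_in_YY[OF y] coord_vec_vertical_dual(1)[OF z]])
      (use x in \<open>auto simp: basic_invariants_def\<close>)
  also have "(\<lambda>t. F (weight_curve z y t))
      = (\<lambda>t. \<Prod>i<nn E. (x i (weight_curve z y t) - x i (base y)) ^ b i)"
    unfolding F_def prH_weight_curve[OF z] sec_prH[OF y] ..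
  finally show ?thesis .
qed

text \<open>By \<open>homogeneous_representation\<close> it suffices to drop the subtracted values
  x_i(\<open>base y\<close>) from each monomial of weight m. The two cases below are the monomials
  with and without a factor of degree at least \<open>dmax E\<close>.\<close>

lemma psi_eq_taylor_coeff:
  assumes x: "basic_invariants E x" and z: "cvec_basis (nn E) z (L \<times> L)"
    and f: "f \<in> SWhom E m" "f \<in> SW E" and m: "0 < m" "m \<le> dmax E"
    and g: "g \<in> Otilde E" "g ` L = L" and \<zeta>: "primitive_root (dmax E) \<zeta>"
    and act: "\<forall>m. \<forall>f\<in>SWhom E m. act_fun g f = fscale (\<zeta> ^ m) f"
    and y: "y \<in> YY E"
  shows "psi E L z x f y = taylor_coeff m (\<lambda>t. f (weight_curve z y t))"
proof -
  let ?w = "weight_curve z y"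
  have deg0: "0 < deg E i" if "i < nn E" for i
    using x that by (auto simp: basic_invariants_def)
  have w: "hol_curve E ?w" by (rule hol_curve_weight_curve[OF z y])
  have xw: "(\<lambda>t. x i (?w t)) holomorphic_on UNIV" if "i < nn E" for i
    using basic_invariants_SWhom[OF x that] by (intro curve_holD[OF FY_curve_hol w]) (simp add: SWhom_def)
  have mono: "(\<lambda>t. monomial E x b (?w t)) holomorphic_on UNIV" for b
    unfolding monomial_def by (intro holomorphic_intros xw) simp
  obtain A h where A: "finite A" "A \<subseteq> multi_index (nn E)" "\<forall>b\<in>A. h b \<in> FH E" "\<forall>b\<in>A. wdeg E b = m"
    and fA: "f = FH_comb E A h (monomial E x)"
    by (rule homogeneous_representation[OF x f])
  have psi_mono: "psi_monomial E L z x b y = taylor_coeff m (\<lambda>t. monomial E x b (?w t))" if "b \<in> A" for b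
  proof -
    have wb: "(\<Sum>i<nn E. deg E i * b i) = m" using A that by (simp add: wdeg_def)
    show ?thesis
    proof (cases "\<exists>k<nn E. 0 < b k \<and> dmax E \<le> deg E k")
      \<comment> \<open>A factor x_k of such a degree uses up the whole weight m \<le>
        \<open>dmax E\<close>, so the monomial is x_k itself. Its value at the base point is a
        constant, which only enters the coefficient of t^0, and m > 0.\<close>
      case True
      then obtain k where k: "k < nn E" "0 < b k" "dmax E \<le> deg E k" by blast
      have "(\<Sum>i<nn E. deg E i * b i) = deg E k * b k + (\<Sum>i\<in>{..<nn E} - {k}. deg E i * b i)"
        using k by (intro sum.remove) auto
      moreover have "deg E k * 1 \<le> deg E k * b k" using k by (intro mult_left_mono) auto
      ultimately have s: "deg E k * b k + (\<Sum>i\<in>{..<nn E} - {k}. deg E i * b i) \<le> deg E k"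
        and s0: "(\<Sum>i\<in>{..<nn E} - {k}. deg E i * b i) = 0"
        using wb k m by linarith+
      have b0: "b i = 0" if "i < nn E" "i \<noteq> k" for i
      proof -
        have "deg E i * b i = 0"
          using s0 that by (subst (asm) sum_eq_0_iff) auto
        then show ?thesis using deg0[OF that(1)] by simp
      qed
      have "deg E k * b k \<le> deg E k * 1" using s s0 by linarith
      then have "b k = 1" using deg0[OF k(1)] k by (simp add: nat_mult_le_cancel1)
      have one: "(\<Prod>i<nn E. c i ^ b i) = c k" for c :: "nat \<Rightarrow> complex"
      proof -
        have "(\<Prod>i<nn E. c i ^ b i) = (\<Prod>i<nn E. if i = k then c k else 1)"
          using b0 \<open>b k = 1\<close> by (intro prod.cong) auto
        also have "\<dots> = c k" using k by (simp del: prod.lessThan_Suc)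
        finally show ?thesis .
      qed
      have "taylor_coeff m (\<lambda>t. x k (?w t) + - x k (base y)) = taylor_coeff m (\<lambda>t. x k (?w t))"
        using m by (subst taylor_coeff_add[OF xw[OF k(1)]]) (auto simp: taylor_coeff_const)
      then show ?thesis
        using wb by (simp only: psi_monomial_eq_taylor_coeff[OF x z y] monomial_def one wdeg_def diff_conv_add_uminus)
    next
      \<comment> \<open>All factors have degree strictly between 0 and \<open>dmax E\<close>, so
        \<zeta> to that degree is not 1 and they vanish at the fixed point
        \<open>base y\<close>.\<close>
      case False
      have "x i (base y) = 0" if "i < nn E" "0 < b i" for i
      proof (rule SWhom_base_eq_0[OF g])
        show "act_fun g (x i) = fscale (\<zeta> ^ deg E i) (x i)"
          using act basic_invariants_SWhom[OF x that(1)] by blast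
        have "deg E i < dmax E" using False that by (meson not_le)
        then show "\<zeta> ^ deg E i \<noteq> 1"
          using \<zeta> deg0[OF that(1)] by (simp add: primitive_root_def)
      qed
      then have "(x i v - x i (base y)) ^ b i = x i v ^ b i" if "i < nn E" for i v
        using that by (cases "b i = 0") auto
      then have "(\<Prod>i<nn E. (x i v - x i (base y)) ^ b i) = monomial E x b v" for v
        unfolding monomial_def by (intro prod.cong) auto
      then show ?thesis
        using A that by (simp add: psi_monomial_eq_taylor_coeff[OF x z y] del: prod.lessThan_Suc)
    qed
  qed
  have fw: "f (?w t) = (\<Sum>b\<in>A. h b (prH E y) * monomial E x b (?w t))" for t
    using weight_curve_in_YY[OF z y, of t] by (simp add: fA FH_comb_def prH_weight_curve[OF z])
  have "psi E L z x f y = (\<Sum>b\<in>A. h b (prH E y) * taylor_coeff m (\<lambda>t. monomial E x b (?w t)))"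
    unfolding psi_eqI[OF x A(1-3) fA] using y psi_mono by (simp add: FH_comb_def)
  also have "\<dots> = taylor_coeff m (\<lambda>t. \<Sum>b\<in>A. h b (prH E y) * monomial E x b (?w t))"
    by (subst taylor_coeff_sum) (auto intro!: holomorphic_on_mult mono simp: taylor_coeff_cmult[OF mono])
  finally show ?thesis unfolding fw .
qed

text \<open>A fixed vector has eigenvalue 1, which only z_k has. In codimension 1, k is the index of
  the unique degree equal to \<open>dmax E\<close>.\<close>

lemma fixed_vector_multiple:
  assumes z: "homogeneous_basis E g \<zeta> L z" and g: "linear g"
    and k: "\<And>i. i < nn E \<Longrightarrow> \<zeta> ^ deg E i = 1 \<Longrightarrow> i = k"
    and v: "v \<in> L" "g v = v"
  obtains c where "(v, 0) = cscale c (z k)"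
proof -
  have "(v, 0) \<in> L \<times> L" using v subspace_0[OF subspace_L] by simp
  then obtain c where c: "(v, 0) = (\<Sum>i<nn E. cscale (c i) (z i))"
    using cvec_basis_expand z unfolding homogeneous_basis_def by metis
  have "map_prod g g (v, 0) = cscale 1 (v, 0)" using v linear_0[OF g] by (simp add: cscale_def)
  from homogeneous_basis_eigenvector_coeff[OF z g c this]
  have "c i = 0" if "i < nn E" "i \<noteq> k" for i using that k by blast
  then have "(\<Sum>i<nn E. cscale (c i) (z i)) = (\<Sum>i<nn E. if i = k then cscale (c k) (z k) else 0)"
    by (intro sum.cong) auto
  also have "\<dots> = cscale (if k < nn E then c k else 0) (z k)"
    by (simp del: sum.lessThan_Suc)
  finally show ?thesis using c that by metis
qed

text \<open>The fixed vectors of L form a line spanned by u, on which I(-, \<delta>) is injective.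
  The factor obtained from the complexification is complex; for real vectors its real part
  suffices.\<close>

lemma fixed_in_F_eq_0:
  assumes z: "homogeneous_basis E g \<zeta> L z" and g: "linear g"
    and k: "\<And>i. i < nn E \<Longrightarrow> \<zeta> ^ deg E i = 1 \<Longrightarrow> i = k"
    and u: "u \<in> L" "II u \<delta> = 1" "g u = u"
    and v: "v \<in> L" "v \<in> Fsp E" "g v = v"
  shows "v = 0"
proof -
  obtain c where c: "(v, 0) = cscale c (z k)" by (rule fixed_vector_multiple[OF z g k v(1,3)])
  obtain d where d: "(u, 0) = cscale d (z k)" by (rule fixed_vector_multiple[OF z g k u(1,3)])
  have "d \<noteq> 0"
  proof
    assume "d = 0"
    then have "u = 0" using d by (simp add: zero_prod_def)
    then show False using u(2) by (simp add: Form_simps)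
  qed
  then have "(v, 0) = cscale (c / d) (u, 0)" by (simp add: c d)
  then have "v = Re (c / d) *\<^sub>R u" by (simp add: cscale_def)
  moreover from this have "Re (c / d) = 0" using v(2) u(2) by (simp add: F_iff Form_simps)
  ultimately show ?thesis by simp
qed

text \<open>Solve (g - 1) W = v in the eigenbasis up to the component of v along z_k. The real part
  r of that component is fixed, and it lies in F because g - 1 maps into F; so it vanishes.\<close>

lemma L_Int_F_range:
  assumes z: "homogeneous_basis E g \<zeta> L z" and g: "linear g" "\<And>u. g u - u \<in> Fsp E" "g ` L = L"
    and k: "\<And>i. i < nn E \<Longrightarrow> \<zeta> ^ deg E i = 1 \<Longrightarrow> i = k" "k < nn E" "\<zeta> ^ deg E k = 1"
    and u: "u \<in> L" "II u \<delta> = 1" "g u = u"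
    and v: "v \<in> L" "v \<in> Fsp E"
  shows "\<exists>w. v = g w - w"
proof -
  have "(v, 0) \<in> L \<times> L" using v subspace_0[OF subspace_L] by simp
  then obtain c where c: "(v, 0) = (\<Sum>i<nn E. cscale (c i) (z i))"
    using cvec_basis_expand z unfolding homogeneous_basis_def by metis
  have zb: "cvec_basis (nn E) z (L \<times> L)" using z by (simp add: homogeneous_basis_def)
  \<comment> \<open>Division by the eigenvalue of g - 1, except at k, where that eigenvalue is
    0.\<close>
  define d where "d i = (if i = k then 0 else c i / (\<zeta> ^ deg E i - 1))" for i
  define W where "W = (\<Sum>i<nn E. cscale (d i) (z i))"
  have "map_prod g g W = (\<Sum>i<nn E. cscale (d i * \<zeta> ^ deg E i) (z i))"
    unfolding W_def map_prod_lincomb[OF g(1)]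
    using z by (intro sum.cong) (auto simp: homogeneous_basis_def)
  then have "map_prod g g W - W = (\<Sum>i<nn E. cscale (d i * (\<zeta> ^ deg E i - 1)) (z i))"
    unfolding W_def sum_subtractf[symmetric]
    by (simp add: sum_subtractf[symmetric] cvec.scale_left_diff_distrib right_diff_distrib
        del: sum.lessThan_Suc)
  also have "\<dots> = (\<Sum>i<nn E. cscale (c i) (z i) - (if i = k then cscale (c k) (z k) else 0))"
  proof (intro sum.cong refl)
    fix i assume "i \<in> {..<nn E}"
    then have "i \<noteq> k \<Longrightarrow> \<zeta> ^ deg E i - 1 \<noteq> 0" using k(1)[of i] by auto
    then show "cscale (d i * (\<zeta> ^ deg E i - 1)) (z i)
        = cscale (c i) (z i) - (if i = k then cscale (c k) (z k) else 0)"
      by (cases "i = k") (simp_all add: d_def)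
  qed
  also have "\<dots> = (v, 0) - cscale (c k) (z k)"
    using k(2) by (simp add: sum_subtractf c del: sum.lessThan_Suc)
  finally have W: "map_prod g g W - W = (v, 0) - cscale (c k) (z k)" .
  \<comment> \<open>First components are real parts: they turn the complex solution W into the real
    witness \<open>fst W\<close>.\<close>
  define r where "r = fst (cscale (c k) (z k))"
  have vr: "v - r = g (fst W) - fst W"
    using arg_cong[OF W, of fst] by (simp add: r_def)
  have "z k \<in> L \<times> L" using cvec_basis_mem[OF zb k(2)] .
  then have rL: "r \<in> L"
    unfolding r_def cscale_def fst_conv by (intro subspace_diff[OF subspace_L] subspace_scale[OF subspace_L]) auto
  have "map_prod g g (z k) = z k" using z k(2,3) by (simp add: homogeneous_basis_def)
  then have "map_prod g g (cscale (c k) (z k)) = cscale (c k) (z k)" by (simp add: map_prod_cscale[OF g(1)])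
  from arg_cong[OF this, of fst] have "g r = r" by (simp add: r_def)
  moreover have "v - (v - r) \<in> Fsp E"
    unfolding vr by (intro subspace_diff[OF subspace_F] v g)
  ultimately have "r = 0" using fixed_in_F_eq_0[OF z g(1) k(1) u rL] by simp
  with vr show ?thesis by auto
qed

end

section \<open>Dependence on the splitting\<close>

text \<open>Both splittings contain the image of g - 1, and their intersections with F lie in it, so
  L and L' have the same intersection with F. It remains to compare the normalized fixed isotropic
  vectors u and u'.\<close>

lemma (in marked_elliptic) zero_type_shift:
  assumes S: "splitting E L" "splitting E L'" and zt: "zero_type E L" "zero_type E L'"
    and g: "g \<in> Otilde E" "\<And>u. g u - u \<in> Fsp E" "g ` L = L" "g ` L' = L'"
    and z: "homogeneous_basis E g \<zeta> L z" "homogeneous_basis E g \<zeta> L' z'"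
    and k: "\<And>i. i < nn E \<Longrightarrow> \<zeta> ^ deg E i = 1 \<Longrightarrow> i = k" "k < nn E" "\<zeta> ^ deg E k = 1"
  obtains s where "\<And>w. w \<in> L' \<Longrightarrow> w - (s * II w \<delta>) *\<^sub>R aa \<in> L"
    and "\<And>w. w \<in> L \<Longrightarrow> w + (s * II w \<delta>) *\<^sub>R aa \<in> L'"
proof -
  interpret S: splitting E L by (rule S(1))
  interpret S': splitting E L' by (rule S(2))
  have lin: "linear g" and rad: "\<And>r. r \<in> radI E \<Longrightarrow> g r = r" using g(1) by (auto simp: Otilde_def)
  obtain u where u: "u \<in> L" "II u \<delta> = 1" "II u u = 0" "g u = u"
    using S.zero_type_vector[OF zt(1) g(1,3,2)] by blast
  obtain u' where u': "u' \<in> L'" "II u' \<delta> = 1" "II u' u' = 0" "g u' = u'"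
    using S'.zero_type_vector[OF zt(2) g(1,4,2)] by blast
  \<comment> \<open>Since g fixes the radical, g - 1 takes the same value on w and on its component
    in L or in L'.\<close>
  have range: "g w - w \<in> L \<and> g w - w \<in> L'" for w
  proof -
    have "g (w - S.radproj w) - (w - S.radproj w) \<in> L"
      using g(3) S.radproj_diff_in[of w] subspace_diff[OF S.subspace_L] by blast
    moreover have "g (w - S'.radproj w) - (w - S'.radproj w) \<in> L'"
      using g(4) S'.radproj_diff_in[of w] subspace_diff[OF S'.subspace_L] by blast
    ultimately show ?thesis
      by (simp add: linear_diff[OF lin] rad S.radproj_in S'.radproj_in)
  qed
  have sub: "v \<in> L'" if "v \<in> L" "v \<in> Fsp E" for v
    using S.L_Int_F_range[OF z(1) lin g(2,3) k u(1,2,4) that] range by blast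
  have sub': "v \<in> L" if "v \<in> L'" "v \<in> Fsp E" for v
    using S'.L_Int_F_range[OF z(2) lin g(2,4) k u'(1,2,4) that] range by blast
  \<comment> \<open>The L-component of u' - u is fixed by g and lies in F, hence is 0; so u' - u is
    in the radical.\<close>
  define v where "v = (u' - u) - S.radproj (u' - u)"
  have vL: "v \<in> L" unfolding v_def by (rule S.radproj_diff_in)
  have "u' - u \<in> Fsp E" using u u' by (simp add: F_iff Form_simps)
  then have vF: "v \<in> Fsp E"
    unfolding v_def by (rule subspace_diff[OF subspace_F _ subsetD[OF radI_subset_F S.radproj_in]])
  have gv: "g v = v"
    unfolding v_def using u u' by (simp add: linear_diff[OF lin] rad[OF S.radproj_in])
  have "v = 0" by (rule S.fixed_in_F_eq_0[OF z(1) lin k(1) u(1,2,4) vL vF gv])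
  then have "u' - u \<in> radI E" using S.radproj_in[of "u' - u"] by (simp add: v_def)
  then obtain s \<beta> where "u' - u = s *\<^sub>R aa + \<beta> *\<^sub>R \<delta>" by (auto simp: radI_eq)
  then have u'_eq: "u' = u + s *\<^sub>R aa + \<beta> *\<^sub>R \<delta>" by (simp add: algebra_simps)
  have "II \<delta> \<delta> = 0" using F_iff d_in_radI radI_subset_F by blast
  \<comment> \<open>Isotropy of u' removes the multiple of \<delta>, leaving only a multiple of
    a.\<close>
  then have "II u' u' = 2 * \<beta>"
    using u Form_sym[of aa] Form_sym[of \<delta> u] unfolding u'_eq by (simp add: Form_simps)
  then have "\<beta> = 0" using u' by simp
  then have u'_eq: "u' = u + s *\<^sub>R aa" using u'_eq by simp
  show ?thesis
  proof (rule that[of s])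
    fix w assume w: "w \<in> L'"
    have "w - II w \<delta> *\<^sub>R u' \<in> L'" by (intro subspace_diff[OF S'.subspace_L] subspace_scale[OF S'.subspace_L] w u')
    then have "w - II w \<delta> *\<^sub>R u' \<in> L" using u' by (intro sub') (simp_all add: F_iff Form_simps)
    then have "(w - II w \<delta> *\<^sub>R u') + II w \<delta> *\<^sub>R u \<in> L"
      by (intro subspace_add[OF S.subspace_L] subspace_scale[OF S.subspace_L] u)
    then show "w - (s * II w \<delta>) *\<^sub>R aa \<in> L" by (simp add: u'_eq algebra_simps)
  next
    fix w assume w: "w \<in> L"
    have "w - II w \<delta> *\<^sub>R u \<in> L" by (intro subspace_diff[OF S.subspace_L] subspace_scale[OF S.subspace_L] w u)
    then have "w - II w \<delta> *\<^sub>R u \<in> L'" using u by (intro sub) (simp_all add: F_iff Form_simps)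
    then have "(w - II w \<delta> *\<^sub>R u) + II w \<delta> *\<^sub>R u' \<in> L'"
      by (intro subspace_add[OF S'.subspace_L] subspace_scale[OF S'.subspace_L] u')
    then show "w + (s * II w \<delta>) *\<^sub>R aa \<in> L'" by (simp add: u'_eq algebra_simps)
  qed
qed

section \<open>The Euler translation attached to a change of splitting\<close>

context marked_elliptic
begin

text \<open>With s from \<open>zero_type_shift\<close> this carries L' into L; it is the identity on
  F.\<close>

definition shift :: "real \<Rightarrow> 'v \<Rightarrow> 'v" where
  "shift s u = u - (s * II u \<delta>) *\<^sub>R aa"

lemma linear_shift: "linear (shift s)"
  by (rule linearI) (auto simp: shift_def Form_simps algebra_simps)

lemma shift_commute:
  assumes g: "g \<in> Otilde E"
  shows "shift s (g u) = g (shift s u)"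
proof -
  have lin: "linear g" and rad: "\<And>r. r \<in> radI E \<Longrightarrow> g r = r"
    and inv: "\<And>u v. II (g u) (g v) = II u v"
    using g by (auto simp: Otilde_def)
  have "II (g u) \<delta> = II u \<delta>" using inv[of u \<delta>] rad[OF d_in_radI] by simp
  then show ?thesis
    by (simp add: shift_def linear_diff[OF lin] linear_scale[OF lin] rad[OF a_in_radI])
qed

text \<open>As y takes the value -2 \<pi> i at a, composing it with the shift adds 2 \<pi> i s I(-,
  \<delta>), and the Euler vector is \<kappa> I(-, \<delta>). The condition on \<tau> matches the
  two constants.\<close>

lemma cpair_shift:
  assumes y: "y \<in> YY E" and \<tau>: "\<tau> * of_real \<kappa> = 2 * of_real pi * \<i> * of_real s"
  shows "cpair w (y + hscale \<tau> (euler_vec E)) = cpair (map_prod (shift s) (shift s) w) y"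
proof -
  obtain p q where w: "w = (p, q)" by (cases w)
  have ya: "blinfun_apply y aa = - 2 * of_real pi * \<i>" using y by (simp add: YY_def)
  have "blinfun_apply (y + hscale \<tau> (euler_vec E)) u = blinfun_apply y (shift s u)" for u
  proof -
    have "blinfun_apply (y + hscale \<tau> (euler_vec E)) u
        = blinfun_apply y u + (\<tau> * of_real \<kappa>) * of_real (II u \<delta>)"
      by (simp add: blinfun.add_left euler_vec_apply)
    also have "\<dots> = blinfun_apply y (shift s u)"
      unfolding \<tau> by (simp add: shift_def blinfun.diff_right blinfun.scaleR_right ya scaleR_conv_of_real)
    finally show ?thesis .
  qed
  then show ?thesis by (simp add: w cpair_def)
qed

text \<open>Compare coordinates with respect to z'. The shift commutes with g, so it takes z'_j to
  an eigenvector in L with the same eigenvalue, and \<open>cpair_weight_curve\<close> applies on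
  both sides.\<close>

lemma weight_curve_shift:
  assumes S: "splitting E L" "splitting E L'" and g: "g \<in> Otilde E"
    and z: "homogeneous_basis E g \<zeta> L z" "homogeneous_basis E g \<zeta> L' z'"
    and \<zeta>: "primitive_root (dmax E) \<zeta>"
    and deg: "\<And>i. i < nn E \<Longrightarrow> 0 < deg E i \<and> deg E i \<le> dmax E"
    and sh: "\<And>w. w \<in> L' \<Longrightarrow> shift s w \<in> L"
    and \<tau>: "\<tau> * of_real \<kappa> = 2 * of_real pi * \<i> * of_real s" and y: "y \<in> YY E"
  shows "splitting.weight_curve E L' z' (y + hscale \<tau> (euler_vec E)) t
    = splitting.weight_curve E L z y t + hscale \<tau> (euler_vec E)"
proof -
  interpret S: splitting E L by (rule S(1))
  interpret S': splitting E L' by (rule S(2))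
  have zb: "cvec_basis (nn E) z (L \<times> L)" and zb': "cvec_basis (nn E) z' (L' \<times> L')"
    using z by (simp_all add: homogeneous_basis_def)
  have lin: "linear g" using g by (simp add: Otilde_def)
  show ?thesis
  proof (rule S'.blinfun_eq_on_basis[OF zb'])
    fix r assume r: "r \<in> radI E"
    show "blinfun_apply (S'.weight_curve z' (y + hscale \<tau> (euler_vec E)) t) r
        = blinfun_apply (S.weight_curve z y t + hscale \<tau> (euler_vec E)) r"
      using S.weight_curve_radI[OF zb r] S'.weight_curve_radI[OF zb' r] by (simp add: blinfun.add_left)
  next
    fix j assume j: "j < nn E"
    let ?K = "map_prod (shift s) (shift s)"
    have zj: "z' j \<in> L' \<times> L'" "map_prod g g (z' j) = cscale (\<zeta> ^ deg E j) (z' j)"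
      using cvec_basis_mem[OF zb' j] z(2) j by (auto simp: homogeneous_basis_def)
    have Kz: "?K (z' j) \<in> L \<times> L" using zj(1) sh by auto
    have "map_prod g g (?K (z' j)) = ?K (map_prod g g (z' j))"
      by (cases "z' j") (simp add: shift_commute[OF g])
    also have "\<dots> = cscale (\<zeta> ^ deg E j) (?K (z' j))"
      unfolding zj(2) by (rule map_prod_cscale[OF linear_shift])
    finally have eig: "map_prod g g (?K (z' j)) = cscale (\<zeta> ^ deg E j) (?K (z' j))" .
    have "cpair (z' j) (S'.weight_curve z' (y + hscale \<tau> (euler_vec E)) t)
        = t ^ deg E j * cpair (z' j) (y + hscale \<tau> (euler_vec E))"
      using deg[OF j] by (intro S'.cpair_weight_curve[OF z(2) lin \<zeta> deg zj]) auto
    also have "\<dots> = t ^ deg E j * cpair (?K (z' j)) y"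
      unfolding cpair_shift[OF y \<tau>] ..
    also have "\<dots> = cpair (?K (z' j)) (S.weight_curve z y t)"
      using deg[OF j] by (intro S.cpair_weight_curve[OF z(1) lin \<zeta> deg Kz eig, symmetric]) auto
    also have "\<dots> = cpair (z' j) (S.weight_curve z y t + hscale \<tau> (euler_vec E))"
      unfolding cpair_shift[OF S.weight_curve_in_YY[OF zb y] \<tau>] ..
    finally show "cpair (z' j) (S'.weight_curve z' (y + hscale \<tau> (euler_vec E)) t)
        = cpair (z' j) (S.weight_curve z y t + hscale \<tau> (euler_vec E))" .
  qed
qed

text \<open>Each x_i is homogeneous of a degree m between 1 and \<open>dmax E\<close>, so
  \<open>psi\<close> for L and for L' are Taylor coefficients along curves that differ by a
  translation by \<tau> times the Euler vector. Hence the image of x_i for L' at y is exp(m \<tau>)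
  times its image for L at the point translated back, which is again linear.\<close>

lemma good_basic_invariants_span_subset:
  assumes act: "\<forall>m. \<forall>f\<in>SWhom E m. act_fun g f = fscale (\<zeta> ^ m) f"
    and codim: "codimension E = 1"
    and zt: "zero_type E L" "zero_type E L'"
    and good: "good_basic_invariants E g \<zeta> L x" "good_basic_invariants E g \<zeta> L' x'"
  shows "cfun.span (x ` {..<nn E}) \<subseteq> cfun.span (x' ` {..<nn E})"
proof -
  have adm: "admissible_triplet E g \<zeta> L" "admissible_triplet E g \<zeta> L'" and x: "basic_invariants E x"
    using good by (simp_all add: good_basic_invariants_def)
  have S: "splitting E L" "splitting E L'"
    using adm by unfold_locales (simp_all add: admissible_triplet_def)
  interpret S: splitting E L by (rule S(1))
  interpret S': splitting E L' by (rule S(2))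
  have g: "g \<in> Otilde E" "\<And>u. g u - u \<in> Fsp E" "g ` L = L" "g ` L' = L'"
    and \<zeta>: "primitive_root (dmax E) \<zeta>"
    using adm by (auto simp: admissible_triplet_def)
  obtain x0 z where x0: "basic_invariants E x0" and z: "homogeneous_basis E g \<zeta> L z"
    and xb: "cfun_basis (nn E) x {f \<in> SW E. psi E L z x0 f \<in> linear_functions E L}"
    using good(1) unfolding good_basic_invariants_def by blast
  obtain x0' z' where x0': "basic_invariants E x0'" and z': "homogeneous_basis E g \<zeta> L' z'"
    and xb': "cfun_basis (nn E) x' {f \<in> SW E. psi E L' z' x0' f \<in> linear_functions E L'}"
    using good(2) unfolding good_basic_invariants_def by blast
  have zb: "cvec_basis (nn E) z (L \<times> L)" and zb': "cvec_basis (nn E) z' (L' \<times> L')"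
    using z z' by (simp_all add: homogeneous_basis_def)
  have pos: "0 < deg E i" if "i < nn E" for i
    using x that by (simp add: basic_invariants_def)
  have mono: "deg E i \<le> deg E j" if "i \<le> j" "j < nn E" for i j
    using x that by (simp add: basic_invariants_def)
  have deg: "0 < deg E i \<and> deg E i \<le> dmax E" if "i < nn E" for i
    using pos[OF that] deg_le_dmax[OF pos mono that] by blast
  obtain k where "{i. i < nn E \<and> deg E i = dmax E} = {k}"
    using codim unfolding codimension_def by (rule card_1_singletonE)
  then have k: "k < nn E" "deg E k = dmax E" "\<And>i. i < nn E \<Longrightarrow> deg E i = dmax E \<Longrightarrow> i = k"
    by blast+
  have k1: "\<zeta> ^ deg E k = 1" using k(2) \<zeta> by (simp add: primitive_root_def)
  have kuniq: "i = k" if "i < nn E" "\<zeta> ^ deg E i = 1" for i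
  proof (rule k(3)[OF that(1)])
    show "deg E i = dmax E"
      using \<zeta> deg[OF that(1)] that(2) unfolding primitive_root_def by (metis le_neq_implies_less)
  qed
  obtain s where s: "\<And>w. w \<in> L' \<Longrightarrow> w - (s * II w \<delta>) *\<^sub>R aa \<in> L"
    "\<And>w. w \<in> L \<Longrightarrow> w + (s * II w \<delta>) *\<^sub>R aa \<in> L'"
    using zero_type_shift[OF S zt g z z' kuniq k(1) k1] by blast
  have sh: "shift s w \<in> L" if "w \<in> L'" for w using s(1)[OF that] by (simp add: shift_def)
  \<comment> \<open>The solution of the condition in \<open>cpair_shift\<close>; dividing is
    legitimate because \<kappa> is nonzero.\<close>
  define \<tau> where "\<tau> = 2 * of_real pi * \<i> * of_real s / of_real \<kappa>"
  have \<tau>: "\<tau> * of_real \<kappa> = 2 * of_real pi * \<i> * of_real s"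
    using \<kappa>_nonzero[OF pos] by (simp add: \<tau>_def)
  let ?e = "euler_vec E"
  have "x i \<in> cfun.span (x' ` {..<nn E})" if i: "i < nn E" for i
  proof -
    let ?m = "deg E i"
    have "x i \<in> cfun.span (x ` {..<nn E})" using i by (intro cfun.span_base) simp
    also have "\<dots> = {f \<in> SW E. psi E L z x0 f \<in> linear_functions E L}"
      using xb by (simp only: cfun_basis_def)
    finally have xSW: "x i \<in> SW E" and xlin: "psi E L z x0 (x i) \<in> linear_functions E L"
      by simp_all
    have xm: "x i \<in> SWhom E ?m" by (rule basic_invariants_SWhom[OF x i])
    obtain p q where pq: "p \<in> L" "q \<in> L"
      and psi: "psi E L z x0 (x i) = (\<lambda>y. if y \<in> YY E then cpair (p, q) y else 0)"
      using xlin unfolding linear_functions_def by blast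
    \<comment> \<open>The preimage of (p, q) under the complexified shift; it lies in the
      complexification of L'.\<close>
    define w where "w = (p + (s * II p \<delta>) *\<^sub>R aa, q + (s * II q \<delta>) *\<^sub>R aa)"
    have w: "w \<in> L' \<times> L'" using pq s(2) by (simp add: w_def)
    have wK: "map_prod (shift s) (shift s) w = (p, q)"
      by (simp add: w_def shift_def Form_simps Form_sym[of aa])
    have "psi E L' z' x0' (x i) y = (if y \<in> YY E then cpair (cscale (exp (of_nat ?m * \<tau>)) w) y else 0)" for y
    proof (cases "y \<in> YY E")
      case True
      define v where "v = y + hscale (- \<tau>) ?e"
      have v: "v \<in> YY E" unfolding v_def by (rule YY_add_vertical[OF True euler_vertical])
      have yv: "y = v + hscale \<tau> ?e"
        by (rule blinfun_eqI) (simp add: v_def blinfun.add_left)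
      have shifted: "S'.weight_curve z' y t = S.weight_curve z v t + hscale \<tau> ?e" for t
        unfolding yv by (rule weight_curve_shift[OF S g(1) z z' \<zeta> deg sh \<tau> v])
      have wv: "hol_curve E (S.weight_curve z v)" by (rule S.hol_curve_weight_curve[OF zb v])
      have hol: "(\<lambda>t. x i (S.weight_curve z v t)) holomorphic_on UNIV"
        using xm by (intro curve_holD[OF FY_curve_hol wv]) (simp add: SWhom_def)
      have "psi E L' z' x0' (x i) y = taylor_coeff ?m (\<lambda>t. x i (S'.weight_curve z' y t))"
        using deg[OF i] by (intro S'.psi_eq_taylor_coeff[OF x0' zb' xm xSW _ _ g(1,4) \<zeta> act True]) auto
      also have "\<dots> = taylor_coeff ?m (\<lambda>t. x i (S.weight_curve z v t + hscale \<tau> ?e))"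
        unfolding shifted ..
      also have "\<dots> = taylor_coeff ?m (\<lambda>t. exp (of_nat ?m * \<tau>) * x i (S.weight_curve z v t))"
        unfolding SWhom_translate[OF xm S.weight_curve_in_YY[OF zb v]] ..
      also have "\<dots> = exp (of_nat ?m * \<tau>) * taylor_coeff ?m (\<lambda>t. x i (S.weight_curve z v t))"
        by (rule taylor_coeff_cmult[OF hol])
      also have "taylor_coeff ?m (\<lambda>t. x i (S.weight_curve z v t)) = psi E L z x0 (x i) v"
        using deg[OF i] by (intro S.psi_eq_taylor_coeff[OF x0 zb xm xSW _ _ g(1,3) \<zeta> act v, symmetric]) auto
      also have "\<dots> = cpair w y"
        unfolding yv cpair_shift[OF v \<tau>] wK psi using v by simp
      finally show ?thesis using True by simp
    next
      \<comment> \<open>Outside the domain both sides are 0 by the convention in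
        \<open>FH_comb\<close>.\<close>
      case False
      obtain A h where "finite A" "A \<subseteq> multi_index (nn E)" "\<forall>b\<in>A. h b \<in> FH E"
        "x i = FH_comb E A h (monomial E x0')"
        using homogeneous_representation[OF x0' xm xSW] by metis
      from psi_eqI[OF x0' this] False show ?thesis by (simp add: FH_comb_def)
    qed
    then have "psi E L' z' x0' (x i) = (\<lambda>y. if y \<in> YY E then cpair (cscale (exp (of_nat ?m * \<tau>)) w) y else 0)"
      by (rule ext)
    moreover have "cscale c w \<in> L' \<times> L'" for c
      using w by (auto simp: cscale_def intro!: subspace_diff[OF S'.subspace_L] subspace_add[OF S'.subspace_L]
          subspace_scale[OF S'.subspace_L])
    ultimately have "psi E L' z' x0' (x i) \<in> linear_functions E L'"
      unfolding linear_functions_def by blast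
    with xSW have "x i \<in> {f \<in> SW E. psi E L' z' x0' f \<in> linear_functions E L'}" by simp
    also have "\<dots> = cfun.span (x' ` {..<nn E})" using xb' by (simp only: cfun_basis_def)
    finally show ?thesis .
  qed
  then show ?thesis
    by (intro cfun.span_minimal cfun.subspace_span) auto
qed

end

theorem proposition7p3:
  fixes E :: "'v::euclidean_space elliptic_data"
    and c css cunip :: "'v \<Rightarrow> 'v"
    and \<zeta> :: complex
    and L L' :: "'v set"
    and x x' :: "nat \<Rightarrow> ('v \<Rightarrow>\<^sub>L complex) \<Rightarrow> complex"
  assumes "marked_elliptic_root_system E"
    and "hyperbolic_coxeter E c"
    and "jordan_decomposition c css cunip"
    and "primitive_root (dmax E) \<zeta>"
    and "\<forall>m. \<forall>f\<in>SWhom E m. act_fun css f = fscale (\<zeta> ^ m) f"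
    and "codimension E = 1"
    and "L \<in> Xinv E css \<inter> Xreg E" and "zero_type E L"
    and "L' \<in> Xinv E css \<inter> Xreg E" and "zero_type E L'"
    and "good_basic_invariants E css \<zeta> L x"
    and "good_basic_invariants E css \<zeta> L' x'"
  shows "cfun.span (x ` {..<nn E}) = cfun.span (x' ` {..<nn E})"
proof -
  interpret marked_elliptic E by unfold_locales (rule assms(1))
  show ?thesis
    using good_basic_invariants_span_subset[OF assms(5,6,8,10,11,12)]
      good_basic_invariants_span_subset[OF assms(5,6,10,8,12,11)] by (rule subset_antisym)
qed

end
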